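(* (1) The set $\{M_\alpha:\alpha \text{ a weak composition}\}$ is a $\mathbf k$-basis of $\mathrm{RenQSym}$. (2) The $\mathbf k$-algebras $\mathrm{RenQSym}$ and $\mathrm{QS}(\mathbb N)$ are isomorphic.
   Context: $\mathbf k$ is a commutative ring containing $\mathbb Q$. $\mathbb P$ and $\mathbb N$ denote positive and nonnegative integers. A weak composition is a finite sequence of nonnegative integers, possibly empty; it is left weak if it is empty or its last entry is positive. Let $X=\{x_i:i\in\mathbb P\}$ be commuting indeterminates. The algebra $\mathrm{QS}(\mathbb N)$. It is the free $\mathbf k$-module with basis all weak compositions. The product is the quasi-shuffle product $*$: $\emptyset$ is the unit, and $$a*b=(a_1,(a_2,\dots,a_m)*b)+(b_1,a*(b_2,\dots,b_n))+(a_1+b_1,(a_2,\dots,a_m)*(b_2,\dots,b_n)),$$ with $(c,\sum\lambda_uu)=\sum\lambda_u(c,u)$. For left weak $\alpha$, $M_\alpha=\sum_{0<i_1<\cdots<i_k}x_{i_1}^{\alpha_1}\cdots x_{i_k}^{\alpha_k}$ ($M_\emptyset=1$). GSym. $\mathrm{GSym}$ is the $\mathbb Q$-span of $\widehat M_{\binom{\gamma}{\mu}}=\sum_{0<i_1<\cdots<i_r}\prod_l i_l^{\mu_l}x_{i_l}^{\gamma_l}$, for $\gamma$ left weak and $\mu\in\mathbb N^r$. Regularization. For $\alpha\in\mathbb N^k$, $\beta\in\mathbb P^k$, $\phi\binom{\alpha}{\beta}\in\mathrm{GSym}[t][z^{-1},z]]$ is obtained from $\sum_{0<i_1<\cdots<i_k}\prod_lx_{i_l}^{\alpha_l}e^{(i_l+t)\beta_lz}$.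 The coefficient of each $X$-monomial converges for $t\ge0$, $\mathrm{Re}(z)<0$; it is expanded as a Laurent series in $z$ with coefficients in $\mathbb Q[t]$, and powers are collected. Renormalization. Let $P$ be the polar-part projection in $z$. Set $\phi_-(\emptyset)=1$ and $E=\phi\binom{\alpha}{\beta}+\sum_{i=1}^{k-1}\phi\binom{\alpha_1..\alpha_i}{\beta_1..\beta_i}\phi_-\binom{\alpha_{i+1}..\alpha_k}{\beta_{i+1}..\beta_k}$. Then $\phi_-\binom{\alpha}{\beta}=-P(E)$, $\phi_+\binom{\alpha}{\beta}=(\mathrm{id}-P)(E)$, and $Z\binom{\alpha}{\beta}=\phi_+\binom{\alpha}{\beta}|_{z=0}$. For any weak composition $\alpha$ of length $k$, $M_\alpha:=Z\binom{\alpha}{\delta,\dots,\delta}$ with $\delta\in\mathbb P$. This is independent of $\delta$ and agrees with the series above for left weak $\alpha$. $\mathrm{RenQSym}$ is the $\mathbf k$-span of all $M_\alpha$ in $\mathbf k[[X]][t]$; it is closed under multiplication. *)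

theory Defs
  imports "HOL-Complex_Analysis.Complex_Analysis" "HOL-Library.Poly_Mapping"
    "HOL-Library.Multiset" "HOL-Computational_Algebra.Polynomial"
begin

type_synonym monom = "nat \<Rightarrow>\<^sub>0 nat"

definition mono_of :: "nat list \<Rightarrow> nat list \<Rightarrow> monom" where
  "mono_of i a = (\<Sum>l<length a. Poly_Mapping.single (i ! l) (a ! l))"

definition idx_set :: "nat list \<Rightarrow> monom \<Rightarrow> nat list set" where
  "idx_set a m = {i. length i = length a \<and> sorted_wrt (<) i \<and> (\<forall>x\<in>set i. 0 < x)
                     \<and> mono_of i a = m}"

text \<open>Coefficient of X^m in sum_{i} prod_l x_{i_l}^{a_l} e^{(i_l+t) b_l z}, as function of z
  (convergent for Re z < 0). Argument ab is the list of columns (a_l, b_l).\<close>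
definition phi_fun :: "real \<Rightarrow> (nat \<times> nat) list \<Rightarrow> monom \<Rightarrow> complex \<Rightarrow> complex" where
  "phi_fun t ab m z = infsum (\<lambda>i. exp (\<Sum>l<length ab.
       (of_nat (i ! l) + complex_of_real t) * of_nat (snd (ab ! l)) * z))
     (idx_set (map fst ab) m)"

type_synonym ser = "monom \<Rightarrow> complex fls"

text \<open>Laurent expansion at z = 0 (of the meromorphic continuation from Re z < 0).\<close>
definition phi :: "real \<Rightarrow> (nat \<times> nat) list \<Rightarrow> ser" where
  "phi t ab m = (THE F. 0 < fls_conv_radius F \<and>
       (\<forall>\<^sub>F z in at 0. Re z < 0 \<longrightarrow> eval_fls F z = phi_fun t ab m z))"

definition ser_mult :: "ser \<Rightarrow> ser \<Rightarrow> ser" where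
  "ser_mult f g m = (\<Sum>p\<in>{(m1, m2). m1 + m2 = m}. f (fst p) * g (snd p))"

definition ser_one :: ser where
  "ser_one m = (if m = 0 then 1 else 0)"

definition polar :: "ser \<Rightarrow> ser" where
  "polar f m = f m - fps_to_fls (fls_regpart (f m))"

function phi_minus :: "real \<Rightarrow> (nat \<times> nat) list \<Rightarrow> ser" where
  "phi_minus t ab = (if ab = [] then ser_one else
     (\<lambda>m. - polar (\<lambda>m. phi t ab m + sum_list (map (\<lambda>i. ser_mult (phi t (take i ab))
          (phi_minus t (drop i ab)) m) [1..<length ab])) m))"
  by pat_completeness auto
termination
  by (relation "Wellfounded.measure (\<lambda>(t, ab). length ab)") auto

definition renE :: "real \<Rightarrow> (nat \<times> nat) list \<Rightarrow> ser" where
  "renE t ab m = phi t ab m + sum_list (map (\<lambda>i. ser_mult (phi t (take i ab))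
          (phi_minus t (drop i ab)) m) [1..<length ab])"

definition phi_plus :: "real \<Rightarrow> (nat \<times> nat) list \<Rightarrow> ser" where
  "phi_plus t ab m = renE t ab m - polar (renE t ab) m"

definition Zval :: "real \<Rightarrow> (nat \<times> nat) list \<Rightarrow> monom \<Rightarrow> complex" where
  "Zval t ab m = fls_nth (phi_plus t ab m) 0"

text \<open>M_alpha := Z(alpha; delta...delta) with delta = 1; coefficient of X^m as element of Q[t].\<close>
definition Mrat :: "nat list \<Rightarrow> monom \<Rightarrow> rat poly" where
  "Mrat a m = (THE p. \<forall>t::real. 0 \<le> t \<longrightarrow>
       poly (map_poly of_rat p) (complex_of_real t) = Zval t (map (\<lambda>x. (x, 1)) a) m)"

section \<open>Scalars: a commutative ring k containing Q\<close>

definition ratk :: "rat \<Rightarrow> 'k::comm_ring_1" where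
  "ratk q = (case quotient_of q of (a, b) \<Rightarrow> of_int a * (THE y. of_int b * y = 1))"

text \<open>Elements of k[[X]][t] represented by coefficient functions: monomial, power of t.\<close>
type_synonym 'k pt = "monom \<Rightarrow> nat \<Rightarrow> 'k"

definition Mk :: "nat list \<Rightarrow> 'k::comm_ring_1 pt" where
  "Mk a m j = ratk (coeff (Mrat a m) j)"

definition pt_lincomb :: "(nat list \<Rightarrow> 'k::comm_ring_1) \<Rightarrow> nat list set \<Rightarrow> 'k pt" where
  "pt_lincomb c S = (\<lambda>m j. \<Sum>a\<in>S. c a * Mk a m j)"

definition RenQSym :: "'k::comm_ring_1 pt set" where
  "RenQSym = {pt_lincomb c S | c S. finite S}"

definition pt_mult :: "'k::comm_ring_1 pt \<Rightarrow> 'k pt \<Rightarrow> 'k pt" where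
  "pt_mult f g m j = (\<Sum>p\<in>{(m1, m2). m1 + m2 = m}. \<Sum>q\<in>{(j1, j2). j1 + j2 = j}.
       f (fst p) (fst q) * g (snd p) (snd q))"

definition pt_one :: "'k::comm_ring_1 pt" where
  "pt_one m j = (if m = 0 \<and> j = 0 then 1 else 0)"

fun qsh :: "nat list \<Rightarrow> nat list \<Rightarrow> nat list multiset" where
  "qsh [] b = {#b#}"
| "qsh a [] = {#a#}"
| "qsh (x # a) (y # b) = image_mset (Cons x) (qsh a (y # b))
     + image_mset (Cons y) (qsh (x # a) b) + image_mset (Cons (x + y)) (qsh a b)"

definition QS :: "(nat list \<Rightarrow> 'k::comm_ring_1) set" where
  "QS = {u. finite {a. u a \<noteq> 0}}"

definition qs_mult :: "(nat list \<Rightarrow> 'k::comm_ring_1) \<Rightarrow> (nat list \<Rightarrow> 'k) \<Rightarrow> nat list \<Rightarrow> 'k" where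
  "qs_mult u v w = (\<Sum>a\<in>{a. u a \<noteq> 0}. \<Sum>b\<in>{b. v b \<noteq> 0}.
       u a * v b * of_nat (count (qsh a b) w))"

definition qs_one :: "nat list \<Rightarrow> 'k::comm_ring_1" where
  "qs_one w = (if w = [] then 1 else 0)"

end

theory Submission
  imports Defs
begin

text \<open>
  Write a weak composition as \<open>\<alpha> 0\<^sup>s\<close> with \<open>\<alpha>\<close> left weak, and let \<open>n\<close> be the largest index of a
  variable in a monomial \<open>m\<close>. With all \<open>\<beta>\<close> equal to 1, the coefficient of \<open>m\<close> in \<open>\<phi>\<close> is a finite sum of
  exponentials times the coefficient of \<open>y\<^sup>s\<close> in \<open>T\<^sub>n(y) = \<Prod>\<^sub>j\<^sub>>\<^sub>n (1 + y e\<^bsup>(j+t)z\<^esup>)\<close>. The logarithmic derivative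
  of \<open>T\<^sub>0\<close> splits into a purely polar part and a regular part with constant term
  \<open>(-t - 1/2) / (1 + y)\<close>; exponentiating gives the Birkhoff decomposition of \<open>T\<^sub>0\<close>. As
  \<open>T\<^sub>0 / T\<^sub>n\<close> is regular, the same counterterms renormalize \<open>T\<^sub>n\<close>, to \<open>(1 + y)\<^bsup>-t-1/2-n\<^esup>\<close> at \<open>z = 0\<close>.

  Hence the coefficient of \<open>m\<close> in \<open>M\<^bsub>\<alpha> 0\<dots>0\<^esub>\<close> is the polynomial in \<open>N\<close> that counts the
  occurrences of \<open>m\<close> in the truncation to \<open>x\<^sub>1, \<dots>, x\<^sub>N\<close>, evaluated at \<open>N = -t - 1/2\<close>. The quasi-shuffle
  product formula and linear independence therefore follow from the case of finitely many variables.
\<close>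

section \<open>Formal exponential solutions\<close>

text \<open>The equation fixes coefficient \<open>Suc k\<close> in terms of the lower ones, since
  \<open>of_nat (Suc k)\<close> can be cancelled in characteristic 0.\<close>

lemma fps_linear_ode_unique:
  fixes A B l :: "'a::field_char_0 fps"
  assumes "fps_deriv A = l * A" "fps_deriv B = l * B" "fps_nth A 0 = fps_nth B 0"
  shows "A = B"
proof (rule fps_ext)
  fix n show "fps_nth A n = fps_nth B n"
  proof (induction n rule: less_induct)
    case (less n)
    show ?case
    proof (cases n)
      case 0 then show ?thesis using assms by simp
    next
      case (Suc k)
      have "fps_nth (fps_deriv A) k = fps_nth (fps_deriv B) k"
        unfolding assms fps_mult_nth by (rule sum.cong) (auto simp: less Suc)
      then have "of_nat (Suc k) * fps_nth A (Suc k) = of_nat (Suc k) * fps_nth B (Suc k)"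
        by (simp del: of_nat_Suc)
      then show ?thesis unfolding Suc by (simp del: of_nat_Suc)
    qed
  qed
qed

fun ode_coeff :: "'a::field_char_0 fps \<Rightarrow> nat \<Rightarrow> 'a" where
  "ode_coeff l 0 = 1"
| "ode_coeff l (Suc n) = (\<Sum>i\<le>n. fps_nth l i * ode_coeff l (n - i)) / of_nat (Suc n)"

text \<open>The exponential of the formal antiderivative of \<open>l\<close>, given by a coefficient
  recursion so that membership of the coefficients in a subset can be followed by induction.\<close>

definition ode_sol :: "'a::field_char_0 fps \<Rightarrow> 'a fps" where
  "ode_sol l = Abs_fps (ode_coeff l)"

lemma ode_sol_nth_0 [simp]: "fps_nth (ode_sol l) 0 = 1"
  by (simp add: ode_sol_def)

lemma ode_sol_deriv: "fps_deriv (ode_sol l) = l * ode_sol l"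
proof (rule fps_ext)
  fix n
  have "fps_nth (fps_deriv (ode_sol l)) n = of_nat (Suc n) * ode_coeff l (Suc n)"
    by (simp add: ode_sol_def del: of_nat_Suc ode_coeff.simps)
  also have "\<dots> = (\<Sum>i\<le>n. fps_nth l i * ode_coeff l (n - i))"
    by (simp del: of_nat_Suc)
  finally show "fps_nth (fps_deriv (ode_sol l)) n = fps_nth (l * ode_sol l) n"
    by (simp add: ode_sol_def fps_mult_nth atMost_atLeast0)
qed

text \<open>Meant also for subsets without a unit, such as the purely polar series: only
  coefficients of positive degree are claimed, because the constant coefficient is 1.\<close>

lemma ode_sol_coeff_in:
  fixes l :: "complex fls fps"
  assumes 0: "0 \<in> S" and add: "\<And>x y. x \<in> S \<Longrightarrow> y \<in> S \<Longrightarrow> x + y \<in> S"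
    and mult: "\<And>x y. x \<in> S \<Longrightarrow> y \<in> S \<Longrightarrow> x * y \<in> S"
    and scale: "\<And>c x. x \<in> S \<Longrightarrow> fls_const c * x \<in> S"
    and l: "\<And>n. fps_nth l n \<in> S"
  shows "fps_nth (ode_sol l) (Suc n) \<in> S"
proof (induction n rule: less_induct)
  case (less n)
  have sum: "sum f I \<in> S" if "\<And>i. i \<in> I \<Longrightarrow> f i \<in> S" for f :: "nat \<Rightarrow> complex fls" and I
    using that by (induction I rule: infinite_finite_induct) (auto simp: 0 add)
  have "fps_nth l i * ode_coeff l (n - i) \<in> S" if "i \<le> n" for i
  \<comment> \<open>For \<open>i = n\<close> the second factor is the coefficient 1, which may lie
    outside \<open>S\<close>; the product is then a coefficient of \<open>l\<close>.\<close>
  proof (cases "n - i")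
    case 0 then show ?thesis using l by simp
  next
    case (Suc k)
    then have "k < n" by simp
    from less[OF this] show ?thesis unfolding Suc by (intro mult l) (simp add: ode_sol_def)
  qed
  then have "(\<Sum>i\<le>n. fps_nth l i * ode_coeff l (n - i)) \<in> S" by (intro sum) auto
  from scale[OF this, of "1 / of_nat (Suc n)"]
  have "fls_const (1 / of_nat (Suc n)) * (\<Sum>i\<le>n. fps_nth l i * ode_coeff l (n - i)) \<in> S" .
  moreover have "fls_const (1 / of_nat (Suc n)) = 1 / (of_nat (Suc n) :: complex fls)"
    by (simp add: field_simps fls_of_nat fls_const_mult_const del: of_nat_Suc)
  ultimately show ?case by (simp add: ode_sol_def del: of_nat_Suc)
qed

section \<open>Regular and purely polar Laurent series\<close>

definition regular_fls :: "complex fls set" where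
  "regular_fls = range fps_to_fls"

definition polar_fls :: "complex fls set" where
  "polar_fls = {F. fls_regpart F = 0}"

lemma regular_fls_iff: "F \<in> regular_fls \<longleftrightarrow> fps_to_fls (fls_regpart F) = F"
  unfolding regular_fls_def by (metis fls_regpart_fps_trivial rangeE rangeI)

lemma regular_fls_closed:
  "0 \<in> regular_fls" "1 \<in> regular_fls" "fls_const c \<in> regular_fls"
  "F \<in> regular_fls \<Longrightarrow> G \<in> regular_fls \<Longrightarrow> F + G \<in> regular_fls"
  "F \<in> regular_fls \<Longrightarrow> G \<in> regular_fls \<Longrightarrow> F - G \<in> regular_fls"
  "F \<in> regular_fls \<Longrightarrow> G \<in> regular_fls \<Longrightarrow> F * G \<in> regular_fls"
  unfolding regular_fls_def
  by (metis fps_zero_to_fls rangeI) (metis fps_one_to_fls rangeI, metis fps_const_to_fls rangeI,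
      (auto simp flip: fps_to_fls_plus fps_to_fls_minus fls_times_fps_to_fls)[3])

lemma regular_fls_sum: "(\<And>i. i \<in> I \<Longrightarrow> f i \<in> regular_fls) \<Longrightarrow> sum f I \<in> regular_fls"
  by (induction I rule: infinite_finite_induct) (auto simp: regular_fls_closed)

lemma regular_fls_mult_nth_0:
  "F \<in> regular_fls \<Longrightarrow> G \<in> regular_fls \<Longrightarrow> fls_nth (F * G) 0 = fls_nth F 0 * fls_nth G 0"
  unfolding regular_fls_def by (auto simp flip: fls_times_fps_to_fls)

lemma polar_fls_iff: "F \<in> polar_fls \<longleftrightarrow> (\<forall>n\<ge>0. fls_nth F n = 0)"
proof -
  have "fls_nth F n = fps_nth (fls_regpart F) (nat n)" if "n \<ge> 0" for n using that by simp
  then show ?thesis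
    by (metis (mono_tags, lifting) fls_regpart_nth fps_ext fps_zero_nth mem_Collect_eq of_nat_0_le_iff polar_fls_def)
qed

lemma polar_fls_closed:
  "0 \<in> polar_fls"
  "F \<in> polar_fls \<Longrightarrow> G \<in> polar_fls \<Longrightarrow> F + G \<in> polar_fls"
  "F \<in> polar_fls \<Longrightarrow> fls_const c * F \<in> polar_fls"
  by (auto simp: polar_fls_iff)

lemma polar_fls_mult:
  assumes "F \<in> polar_fls" "G \<in> polar_fls"
  shows "F * G \<in> polar_fls"
  unfolding polar_fls_iff
proof (intro allI impI)
  fix n :: int assume n: "0 \<le> n"
  show "fls_nth (F * G) n = 0"
    unfolding fls_times_nth(2)
  proof (rule sum.neutral, intro ballI)
    fix i
    \<comment> \<open>Two negative exponents cannot have the nonnegative sum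
      \<open>n\<close>.\<close>
    have "0 \<le> i \<or> 0 \<le> n - i" using n by linarith
    then show "fls_nth F i * fls_nth G (n - i) = 0" using assms by (auto simp: polar_fls_iff)
  qed
qed

section \<open>Generating series of the tails\<close>

definition expz :: "complex \<Rightarrow> complex fls" where
  "expz c = fps_to_fls (fps_exp c)"

lemma expz_add: "expz (a + b) = expz a * expz b"
  by (simp add: expz_def fps_exp_add_mult fls_times_fps_to_fls)

lemma expz_0 [simp]: "expz 0 = 1"
  by (simp add: expz_def)

lemma expz_regular: "expz c \<in> regular_fls"
  by (simp add: expz_def regular_fls_def)

lemma expz_nth_0 [simp]: "fls_nth (expz c) 0 = 1"
  by (simp add: expz_def)

lemma expz_neq_1: "c \<noteq> 0 \<Longrightarrow> expz c \<noteq> 1"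
  by (auto simp: expz_def fps_eq_iff intro!: exI[of _ 1])

lemma expz_power: "expz c ^ n = expz (of_nat n * c)"
  by (induction n) (simp_all add: expz_add algebra_simps)

text \<open>With \<open>q = e^z\<close>, this is the expansion of the sum of
  \<open>q^(j_1 + ... + j_s + s t)\<close> over \<open>n < j_1 < ... < j_s\<close>, in its closed
  form as an iterated geometric series.\<close>

definition tail :: "complex \<Rightarrow> nat \<Rightarrow> nat \<Rightarrow> complex fls" where
  "tail t n s = expz (of_nat s * (t + of_nat n)) *
     (\<Prod>l=1..s. expz (of_nat l) / (1 - expz (of_nat l)))"

lemma tail_0 [simp]: "tail t n 0 = 1"
  by (simp add: tail_def)

lemma tail_shift: "tail t (Suc n) s = expz (of_nat s) * tail t n s"
proof -
  have "expz (of_nat s * (t + of_nat (Suc n))) = expz (of_nat s) * expz (of_nat s * (t + of_nat n))"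
    by (simp add: algebra_simps flip: expz_add)
  then show ?thesis by (simp add: tail_def)
qed

text \<open>Case distinction on whether the smallest index is \<open>n + 1\<close>; it follows from
  the closed form on multiplying \<open>tail t n (Suc s)\<close> by
  \<open>1 - q^(s+1)\<close>.\<close>

lemma tail_Suc:
  "tail t n (Suc s) = tail t (Suc n) (Suc s) + expz (t + of_nat (Suc n)) * tail t (Suc n) s"
proof -
  let ?K = "\<Prod>l=1..s. expz (of_nat l) / (1 - expz (of_nat l))"
  have ne: "1 - expz (of_nat (Suc s)) \<noteq> 0" using expz_neq_1[of "of_nat (Suc s)"] by (simp del: of_nat_Suc)
  have "(1 - expz (of_nat (Suc s))) * tail t n (Suc s)
     = expz (of_nat (Suc s) * (t + of_nat n)) * expz (of_nat (Suc s)) * ?K"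
    using ne by (simp add: tail_def del: of_nat_Suc)
  also have "\<dots> = expz (t + of_nat (Suc n)) * tail t (Suc n) s"
  proof -
    have "expz (of_nat (Suc s) * (t + of_nat n)) * expz (of_nat (Suc s))
      = expz (t + of_nat (Suc n)) * expz (of_nat s * (t + of_nat (Suc n)))"
      by (simp add: algebra_simps flip: expz_add)
    then show ?thesis by (simp add: tail_def mult.assoc)
  qed
  finally show ?thesis by (simp add: tail_shift algebra_simps del: of_nat_Suc)
qed

text \<open>The series \<open>T_n(y)\<close> of the introduction: the formal variable is
  \<open>y\<close>, and the coefficients are Laurent series in \<open>z\<close>.\<close>

definition tail_gf :: "complex \<Rightarrow> nat \<Rightarrow> complex fls fps" where
  "tail_gf t n = Abs_fps (tail t n)"

lemma tail_gf_rec: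
  "tail_gf t n = (1 + fps_X * fps_const (expz (t + of_nat (Suc n)))) * tail_gf t (Suc n)"
proof (rule fps_ext)
  fix s show "fps_nth (tail_gf t n) s = fps_nth ((1 + fps_X * fps_const (expz (t + of_nat (Suc n)))) * tail_gf t (Suc n)) s"
    by (cases s) (simp_all add: tail_gf_def tail_Suc[of t n] distrib_right mult.assoc del: of_nat_Suc)
qed

section \<open>Dilation of \<open>y\<close> by \<open>q = e^z\<close> and the logarithmic derivative
  of the tails\<close>

definition q_scale :: "complex fls fps \<Rightarrow> complex fls fps" where
  "q_scale F = Abs_fps (\<lambda>n. expz (of_nat n) * fps_nth F n)"

lemma q_scale_mult: "q_scale (F * G) = q_scale F * q_scale G"
proof (rule fps_ext)
  fix n
  have "expz (of_nat n) * (fps_nth F i * fps_nth G (n - i)) =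
     expz (of_nat i) * fps_nth F i * (expz (of_nat (n - i)) * fps_nth G (n - i))" if "i \<le> n" for i
  proof -
    have "expz (of_nat n) = expz (of_nat i) * expz (of_nat (n - i))"
      using that by (simp flip: expz_add of_nat_add)
    then show ?thesis by (simp only: mult_ac)
  qed
  then show "fps_nth (q_scale (F * G)) n = fps_nth (q_scale F * q_scale G) n"
    unfolding q_scale_def fps_mult_nth fps_nth_Abs_fps sum_distrib_left
    by (intro sum.cong) auto
qed

lemma q_scale_deriv: "fps_deriv (q_scale F) = fps_const (expz 1) * q_scale (fps_deriv F)"
  by (rule fps_ext) (simp add: q_scale_def expz_add algebra_simps)

lemma q_scale_diff: "q_scale (F - G) = q_scale F - q_scale G"
  by (rule fps_ext) (simp add: q_scale_def algebra_simps)

text \<open>The dilation raises every index \<open>j\<close> in the product by one, which removes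
  the factor \<open>j = n + 1\<close>.\<close>

lemma tail_gf_q_scale: "tail_gf t (Suc n) = q_scale (tail_gf t n)"
  by (rule fps_ext) (simp add: tail_gf_def q_scale_def tail_shift)

text \<open>The logarithmic derivative of \<open>T_0(y)\<close>: the coefficient of
  \<open>y^n\<close> in the sum over \<open>j >= 1\<close> of
  \<open>e^((j+t)z) / (1 + y e^((j+t)z))\<close> is a geometric series of ratio
  \<open>e^((n+1)z)\<close>.\<close>

definition log_tail :: "complex \<Rightarrow> complex fls fps" where
  "log_tail t = Abs_fps (\<lambda>n. (- 1) ^ n * (expz (of_nat (Suc n) * (t + 1)) / (1 - expz (of_nat (Suc n)))))"

text \<open>Dilating and multiplying by \<open>q\<close> drops the summand \<open>j = 1\<close> of
  the logarithmic derivative. The difference is this summand, stated with its denominator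
  cleared.\<close>

lemma log_tail_q_scale:
  "(1 + fps_X * fps_const (expz (t + 1))) * (log_tail t - fps_const (expz 1) * q_scale (log_tail t))
     = fps_const (expz (t + 1))"
proof -
  have nth: "fps_nth (log_tail t - fps_const (expz 1) * q_scale (log_tail t)) n
       = (- 1) ^ n * expz (t + 1) ^ Suc n" for n
  proof -
    have ne: "1 - expz (of_nat (Suc n)) \<noteq> 0" using expz_neq_1[of "of_nat (Suc n)"] by (simp del: of_nat_Suc)
    have "expz 1 * (expz (of_nat n) * x) = expz (of_nat (Suc n)) * x" for x
      by (simp add: expz_add algebra_simps)
    then have "fps_nth (log_tail t - fps_const (expz 1) * q_scale (log_tail t)) n
      = (1 - expz (of_nat (Suc n))) * fps_nth (log_tail t) n"
      by (simp add: q_scale_def left_diff_distrib)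
    also have "\<dots> = (- 1) ^ n * expz (of_nat (Suc n) * (t + 1))"
      using ne by (simp add: log_tail_def del: of_nat_Suc)
    finally show ?thesis by (simp only: expz_power)
  qed
  show ?thesis
  proof (rule fps_ext)
    fix n show "fps_nth ((1 + fps_X * fps_const (expz (t + 1))) * (log_tail t - fps_const (expz 1) * q_scale (log_tail t))) n
      = fps_nth (fps_const (expz (t + 1))) n"
      unfolding distrib_right mult.assoc mult_1_left fps_add_nth
      by (cases n) (simp_all only: nth fps_mult_left_const_nth fps_X_mult_nth, simp_all)
  qed
qed

text \<open>The defect \<open>V\<close> of the differential equation satisfies the same \<open>q\<close>-difference equation
  as the series, up to a factor \<open>q\<close> that forces its coefficients to vanish.\<close>
lemma tail_gf_deriv: "fps_deriv (tail_gf t 0) = log_tail t * tail_gf t 0"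
proof -
  define T where "T = tail_gf t 0"
  define l where "l = log_tail t"
  define c where "c = expz (t + 1)"
  define u where "u = 1 + fps_X * fps_const c"
  define V where "V = fps_deriv T - l * T"
  define q where "q = fps_const (expz 1)"
  have T: "T = u * q_scale T"
    using tail_gf_rec[of t 0] by (simp add: T_def u_def c_def tail_gf_q_scale)
  have du: "fps_deriv u = fps_const c" by (simp add: u_def)
  have l: "u * l = u * (q * q_scale l) + fps_const c"
    using log_tail_q_scale[of t] by (simp add: u_def c_def l_def q_def algebra_simps)
  have "fps_deriv T = u * (q * q_scale (fps_deriv T)) + fps_const c * q_scale T"
    by (subst T) (simp add: du q_scale_deriv q_def)
  moreover have "l * T = u * (q * q_scale (l * T)) + fps_const c * q_scale T"
  proof -
    have "l * T = u * l * q_scale T" by (subst T) simp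
    also have "\<dots> = (u * (q * q_scale l) + fps_const c) * q_scale T" by (simp only: l)
    also have "\<dots> = u * (q * q_scale (l * T)) + fps_const c * q_scale T"
      by (simp only: q_scale_mult algebra_simps)
    finally show ?thesis .
  qed
  ultimately have "V = (u * (q * q_scale (fps_deriv T)) + fps_const c * q_scale T)
      - (u * (q * q_scale (l * T)) + fps_const c * q_scale T)"
    unfolding V_def by (rule arg_cong2[where f = minus])
  also have "\<dots> = u * (q * q_scale V)"
    by (simp add: V_def q_scale_diff right_diff_distrib)
  finally have V: "V = u * (q * q_scale V)" .
  have nthV: "fps_nth V n = expz (of_nat (Suc n)) * fps_nth V n
       + (if n = 0 then 0 else c * (expz (of_nat n) * fps_nth V (n - 1)))" for n
  proof -
    have e: "expz 1 * (expz (of_nat m) * x) = expz (of_nat (Suc m)) * x" for m x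
      by (simp add: expz_add algebra_simps)
    have nq: "fps_nth (q * q_scale V) m = expz (of_nat (Suc m)) * fps_nth V m" for m
      by (simp add: q_def q_scale_def e del: of_nat_Suc)
    have "fps_nth V n = fps_nth (q * q_scale V + fps_X * (fps_const c * (q * q_scale V))) n"
      by (subst V) (simp add: u_def algebra_simps)
    also have "\<dots> = fps_nth (q * q_scale V) n
       + (if n = 0 then 0 else c * fps_nth (q * q_scale V) (n - 1))"
      by (cases n) (simp_all add: fps_mult_left_const_nth[of c])
    finally show ?thesis unfolding nq by (cases n) (simp_all del: of_nat_Suc)
  qed
  have "fps_nth V n = 0" for n
  proof (induction n)
    case 0
    show ?case using nthV[of 0] expz_neq_1[of 1] by auto
  next
    case (Suc n)
    have "fps_nth V (Suc n) * (1 - expz (of_nat (Suc (Suc n)))) = 0"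
      using nthV[of "Suc n"] Suc by (simp add: algebra_simps del: of_nat_Suc)
    then show ?case using expz_neq_1[of "of_nat (Suc (Suc n))"] by (simp del: of_nat_Suc)
  qed
  then have "V = 0" by (simp add: fps_eq_iff)
  then show ?thesis by (simp add: V_def T_def l_def)
qed

text \<open>Since \<open>1 - e\<^sup>n\<^sup>z = -n z (1 + n z / 2 + \<dots>)\<close>, the quotient is \<open>-1 / (n z) - (t + 1/2) + \<dots>\<close>;
  its constant term does not depend on \<open>n\<close>.\<close>
lemma expz_quotient_nth_0:
  assumes "n > 0"
  shows "fls_nth (expz (of_nat n * (t + 1)) / (1 - expz (of_nat n))) 0 = - t - 1 / 2"
proof -
  define N :: complex where "N = of_nat n"
  have N: "N \<noteq> 0" using assms by (simp add: N_def)
  define u where "u = fps_shift 1 (fps_exp N - 1)"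
  define h where "h = fps_exp (N * (t + 1)) / u"
  have u0: "fps_nth u 0 = N" and u1: "fps_nth u 1 = N ^ 2 / 2"
    by (simp_all add: u_def fact_2 numeral_2_eq_2 fps_exp_def)
  have hu: "h * u = fps_exp (N * (t + 1))"
    unfolding h_def using u0 N by (simp add: fps_divide_unit inverse_mult_eq_1 mult.assoc)
  have "fps_nth (h * u) 0 = 1" "fps_nth (h * u) 1 = N * (t + 1)"
    by (simp_all add: hu)
  then have h0: "fps_nth h 0 = 1 / N" and h1': "fps_nth h 0 * (N ^ 2 / 2) + fps_nth h 1 * N = N * (t + 1)"
    using N by (simp_all add: fps_mult_nth u0 u1[unfolded One_nat_def] nonzero_eq_divide_eq)
  have h1: "fps_nth h 1 = t + 1 / 2"
  proof -
    have "N * fps_nth h 1 = N * (t + 1 / 2)"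
      using h1' N unfolding h0 by (simp add: field_simps power2_eq_square)
    then show ?thesis using N by simp
  qed
  have X: "fps_X * u = fps_exp N - 1"
    by (rule fps_ext) (auto simp: u_def)
  have "expz N - 1 = fls_X * fps_to_fls u"
    by (simp add: expz_def X flip: fps_X_to_fls fls_times_fps_to_fls)
  then have "1 - expz N = - (fls_X * fps_to_fls u)" by (simp add: algebra_simps)
  moreover have "expz (N * (t + 1)) = fps_to_fls h * fps_to_fls u"
    by (simp add: expz_def fls_times_fps_to_fls flip: hu)
  moreover have "fps_to_fls u \<noteq> 0" using u0 N by auto
  ultimately have "expz (N * (t + 1)) / (1 - expz N) = - fls_shift 1 (fps_to_fls h)"
    by simp
  then show ?thesis using h1 by (simp add: N_def)
qed

lemma log_tail_nth_0: "fls_nth (fps_nth (log_tail t) n) 0 = (- 1) ^ n * (- t - 1 / 2)"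
proof -
  have "fls_nth ((- 1) ^ n * F) 0 = (- 1) ^ n * fls_nth F 0" for F :: "complex fls"
    by (cases "even n") simp_all
  then show ?thesis
    unfolding log_tail_def
    by (simp add: expz_quotient_nth_0 del: of_nat_Suc times_divide_eq_right)
qed

section \<open>Algebraic Birkhoff decomposition of the tails\<close>

definition reg_log :: "complex \<Rightarrow> complex fls fps" where
  "reg_log t = Abs_fps (\<lambda>n. fps_to_fls (fls_regpart (fps_nth (log_tail t) n)))"

text \<open>The exponential of minus the integrated polar part of \<open>log_tail t\<close>. Its
  coefficients turn out to be the counterterms of the words \<open>0...0\<close>.\<close>

definition counter_gf :: "complex \<Rightarrow> complex fls fps" where
  "counter_gf t = ode_sol (reg_log t - log_tail t)"

lemma counter_gf_0 [simp]: "fps_nth (counter_gf t) 0 = 1"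
  by (simp add: counter_gf_def)

lemma counter_gf_polar: "fps_nth (counter_gf t) (Suc n) \<in> polar_fls"
proof -
  have "fps_nth (reg_log t - log_tail t) k \<in> polar_fls" for k
    by (simp add: reg_log_def polar_fls_def)
  then show ?thesis
    unfolding counter_gf_def by (intro ode_sol_coeff_in polar_fls_closed polar_fls_mult)
qed

text \<open>Logarithmic derivatives add and the polar parts cancel, so both sides solve the same
  linear equation with constant term 1.\<close>

lemma tail_gf_mult_counter_gf: "tail_gf t 0 * counter_gf t = ode_sol (reg_log t)"
proof (rule fps_linear_ode_unique)
  show "fps_deriv (tail_gf t 0 * counter_gf t) = reg_log t * (tail_gf t 0 * counter_gf t)"
    by (simp add: tail_gf_deriv counter_gf_def ode_sol_deriv algebra_simps)
qed (simp_all add: ode_sol_deriv tail_gf_def)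

text \<open>Setting \<open>z = 0\<close> is multiplicative on regular series and turns the
  differential equation into that of the binomial series \<open>(1 + y)^(-t - 1/2)\<close>.\<close>

lemma ode_sol_reg_log:
  "fps_nth (ode_sol (reg_log t)) n \<in> regular_fls"
  "fls_nth (fps_nth (ode_sol (reg_log t)) n) 0 = (- t - 1 / 2) gchoose n"
proof -
  let ?R = "ode_sol (reg_log t)"
  have l: "fps_nth (reg_log t) n \<in> regular_fls" for n by (simp add: reg_log_def regular_fls_def)
  show reg: "fps_nth ?R n \<in> regular_fls" for n
  proof (cases n)
    case (Suc k)
    show ?thesis unfolding Suc
      by (rule ode_sol_coeff_in) (auto simp: regular_fls_closed l)
  qed (simp add: regular_fls_closed)
  define B where "B = Abs_fps (\<lambda>n. fls_nth (fps_nth ?R n) 0)"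
  \<comment> \<open>By \<open>log_tail_nth_0\<close> this is \<open>reg_log t\<close> at
    \<open>z = 0\<close>, the expansion of \<open>(-t - 1/2) / (1 + y)\<close>.\<close>
  define r where "r = Abs_fps (\<lambda>n. (- 1) ^ n * (- t - 1 / 2))"
  have "fps_deriv B = r * B"
  proof (rule fps_ext)
    fix n
    have "fls_nth (fps_nth (fps_deriv ?R) n) 0 = fls_nth (fps_nth (reg_log t * ?R) n) 0"
      by (simp add: ode_sol_deriv)
    also have "\<dots> = fps_nth (r * B) n"
      by (simp add: fps_mult_nth fls_nth_sum regular_fls_mult_nth_0 l reg B_def r_def)
         (simp add: reg_log_def log_tail_nth_0)
    also have "fls_nth (fps_nth (fps_deriv ?R) n) 0 = fps_nth (fps_deriv B) n"
      by (simp add: B_def fls_of_nat del: of_nat_Suc)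
    finally show "fps_nth (fps_deriv B) n = fps_nth (r * B) n" .
  qed
  moreover have "r * (1 + fps_X) = fps_const (- t - 1 / 2)"
  proof (rule fps_ext)
    fix n show "fps_nth (r * (1 + fps_X)) n = fps_nth (fps_const (- t - 1 / 2)) n"
      by (cases n) (simp_all add: r_def distrib_left)
  qed
  ultimately have "fps_deriv B * (1 + fps_X) = fps_const (- t - 1 / 2) * B"
    by (simp add: algebra_simps)
  moreover have ne: "(1 + fps_X :: complex fps) \<noteq> 0" by (rule fps_nonzeroI[of _ 0]) simp
  ultimately have "fps_deriv B = fps_const (- t - 1 / 2) * B / (1 + fps_X)"
    by (metis ne nonzero_mult_div_cancel_right)
  then have "B = fps_binomial (- t - 1 / 2)"
    by (subst fps_binomial_ODE_unique'[symmetric]) (simp add: B_def)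
  then have "fps_nth B n = (- t - 1 / 2) gchoose n" by simp
  then show "fls_nth (fps_nth ?R n) 0 = (- t - 1 / 2) gchoose n" by (simp add: B_def)
qed

text \<open>\<open>T_n\<close> and \<open>T_(n+1)\<close> differ by the regular factor
  \<open>1 + e y\<close>, so the counterterms of \<open>T_0\<close> serve every \<open>n\<close>; at
  \<open>z = 0\<close> each factor lowers the binomial exponent by one.\<close>

lemma ren_tail:
  "fps_nth (tail_gf t n * counter_gf t) s \<in> regular_fls \<and>
   fls_nth (fps_nth (tail_gf t n * counter_gf t) s) 0 = (- t - 1 / 2 - of_nat n) gchoose s"
proof (induction n arbitrary: s)
  case 0
  show ?case by (simp add: tail_gf_mult_counter_gf ode_sol_reg_log)
next
  case (Suc n)
  note IH = this
  define U where "U n = tail_gf t n * counter_gf t" for n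
  define e where "e = expz (t + of_nat (Suc n))"
  define w where "w = - t - 1 / 2 - of_nat (Suc n)"
  have w: "- t - 1 / 2 - of_nat n = w + 1" by (simp add: w_def)
  have U: "U n = U (Suc n) + fps_X * (fps_const e * U (Suc n))"
    unfolding U_def e_def by (subst tail_gf_rec) (simp add: algebra_simps)
  \<comment> \<open>Division by \<open>1 + e y\<close> is carried out degree by degree in
    \<open>y\<close>; at \<open>z = 0\<close> the recursion becomes Pascal's rule.\<close>
  have "fps_nth (U (Suc n)) s \<in> regular_fls \<and> fls_nth (fps_nth (U (Suc n)) s) 0 = w gchoose s" for s
  proof (induction s)
    case 0
    show ?case by (simp add: U_def tail_gf_def regular_fls_closed)
  next
    case (Suc s)
    have *: "fps_nth (U (Suc n)) (Suc s) = fps_nth (U n) (Suc s) - e * fps_nth (U (Suc n)) s"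
      by (subst U) simp
    have "fps_nth (U n) (Suc s) \<in> regular_fls" "fls_nth (fps_nth (U n) (Suc s)) 0 = (w + 1) gchoose Suc s"
      using IH[of "Suc s"] unfolding U_def w by auto
    then show ?case unfolding * using Suc.IH
      by (simp add: regular_fls_closed expz_regular e_def regular_fls_mult_nth_0 gbinomial_Suc_Suc del: of_nat_Suc)
  qed
  then show ?case unfolding U_def w_def by blast
qed

section \<open>Index sets\<close>

lemma mono_of_Nil [simp]: "mono_of [] [] = 0"
  by (simp add: mono_of_def)

lemma mono_of_Cons [simp]: "mono_of (x # i) (y # a) = Poly_Mapping.single x y + mono_of i a"
  unfolding mono_of_def by (simp add: sum.lessThan_Suc_shift del: sum.lessThan_Suc)

lemma mono_of_append:
  "length i = length a \<Longrightarrow> mono_of (i @ j) (a @ b) = mono_of i a + mono_of j b"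
  by (induction i a rule: list_induct2) (simp_all add: add.assoc)

lemma mono_of_replicate_0: "length i = s \<Longrightarrow> mono_of i (replicate s 0) = 0"
  by (induction i arbitrary: s) auto

lemma keys_mono_of: "length i = length a \<Longrightarrow> Poly_Mapping.keys (mono_of i a) \<subseteq> set i"
proof (induction i a rule: list_induct2)
  case (Cons x i y a)
  have "Poly_Mapping.keys (Poly_Mapping.single x y + mono_of i a) \<subseteq> Poly_Mapping.keys (Poly_Mapping.single x y) \<union> Poly_Mapping.keys (mono_of i a)"
    by (rule Poly_Mapping.keys_add)
  then show ?case using Cons by (auto split: if_splits)
qed simp

text \<open>The value 0 for the unit monomial suits positive indices: a tail beyond it starts at
  index 1.\<close>

definition top_var :: "monom \<Rightarrow> nat" where
  "top_var m = (if m = 0 then 0 else Max (Poly_Mapping.keys m))"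

lemma keys_le_top_var: "x \<in> Poly_Mapping.keys m \<Longrightarrow> x \<le> top_var m"
  by (auto simp: top_var_def)

text \<open>A nonzero last exponent makes the largest index visible in the monomial.\<close>

lemma top_var_mono_of:
  assumes "length i = length a" "sorted_wrt (<) i" "i \<noteq> []" "last a \<noteq> 0"
  shows "top_var (mono_of i a) = last i"
proof -
  obtain i0 x where i: "i = i0 @ [x]" using assms(3) by (cases i rule: rev_cases) auto
  obtain a0 y where a: "a = a0 @ [y]" using assms(1,3) by (cases a rule: rev_cases) auto
  have m: "mono_of i a = mono_of i0 a0 + Poly_Mapping.single x y"
    using assms(1) by (simp add: i a mono_of_append)
  have "x \<in> Poly_Mapping.keys (mono_of i a)"
    unfolding m using assms(4) by (simp add: in_keys_iff lookup_add a)
  moreover have "y \<le> x" if "y \<in> Poly_Mapping.keys (mono_of i a)" for y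
    using subsetD[OF keys_mono_of[OF assms(1)] that] assms(2) by (auto simp: i sorted_wrt_append)
  ultimately have "Max (Poly_Mapping.keys (mono_of i a)) = x" by (intro Max_eqI) auto
  then show ?thesis using \<open>x \<in> _\<close> by (auto simp: top_var_def i)
qed

definition incr_lists :: "nat \<Rightarrow> nat \<Rightarrow> nat list set" where
  "incr_lists s n = {j. length j = s \<and> sorted_wrt (<) j \<and> (\<forall>x\<in>set j. n < x)}"

lemma idx_set_top:
  assumes "i \<in> idx_set a m" "a = [] \<or> last a \<noteq> 0"
  shows "(\<forall>x\<in>set i. x \<le> top_var m) \<and> (i = [] \<longrightarrow> top_var m = 0) \<and> (i \<noteq> [] \<longrightarrow> last i = top_var m)"
proof (cases "i = []")
  case True
  then show ?thesis using assms by (auto simp: idx_set_def top_var_def)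
next
  case False
  then have *: "length i = length a" "sorted_wrt (<) i" "a \<noteq> []" "mono_of i a = m"
    using assms by (auto simp: idx_set_def)
  then have "last i = top_var m" using top_var_mono_of[of i a] assms(2) False by auto
  moreover have "x \<le> last i" if "x \<in> set i" for x
    using that *(2) False by (cases i rule: rev_cases) (auto simp: sorted_wrt_append)
  ultimately show ?thesis using False by auto
qed

lemma finite_idx_set:
  assumes "a = [] \<or> last a \<noteq> 0"
  shows "finite (idx_set a m)"
proof (rule finite_subset)
  show "idx_set a m \<subseteq> {xs. set xs \<subseteq> {..top_var m} \<and> length xs = length a}"
    using idx_set_top[OF _ assms] by (auto simp: idx_set_def)
qed (simp add: finite_lists_length_eq)

text \<open>Trailing zeros leave no trace in the monomial, so their indices are constrained only by
  the order. The bound they must exceed is the last index of the head, which is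
  \<open>top_var m\<close> whichever head list \<open>i\<close> is chosen.\<close>

lemma idx_set_append_zeros:
  assumes "a = [] \<or> last a \<noteq> 0"
  shows "idx_set (a @ replicate s 0) m = (\<Union>i\<in>idx_set a m. (@) i ` incr_lists s (top_var m))"
proof (intro equalityI subsetI)
  fix k assume k: "k \<in> idx_set (a @ replicate s 0) m"
  define i j where "i = take (length a) k" and "j = drop (length a) k"
  have kij: "k = i @ j" and len: "length i = length a" "length j = s"
    using k by (auto simp: i_def j_def idx_set_def)
  have i: "i \<in> idx_set a m"
    using k len unfolding kij by (auto simp: idx_set_def mono_of_append mono_of_replicate_0 sorted_wrt_append)
  have "top_var m < x" if "x \<in> set j" for x
  \<comment> \<open>For an empty head \<open>top_var m = 0\<close>, and the claim is the positivity
    of indices; otherwise \<open>top_var m\<close> is the last head index.\<close>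
  proof (cases "i = []")
    case True
    then show ?thesis using k that idx_set_top[OF i assms] unfolding kij by (auto simp: idx_set_def)
  next
    case False
    then have "last i < x" using k that unfolding kij by (auto simp: idx_set_def sorted_wrt_append)
    then show ?thesis using idx_set_top[OF i assms] False by auto
  qed
  then have "j \<in> incr_lists s (top_var m)"
    using k len unfolding kij by (auto simp: incr_lists_def idx_set_def sorted_wrt_append)
  then show "k \<in> (\<Union>i\<in>idx_set a m. (@) i ` incr_lists s (top_var m))"
    using i kij by auto
next
  fix k assume "k \<in> (\<Union>i\<in>idx_set a m. (@) i ` incr_lists s (top_var m))"
  then obtain i j where kij: "k = i @ j" and i: "i \<in> idx_set a m" and j: "j \<in> incr_lists s (top_var m)"
    by auto
  have "x < y" if "x \<in> set i" "y \<in> set j" for x y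
    using idx_set_top[OF i assms] j that by (fastforce simp: incr_lists_def)
  then show "k \<in> idx_set (a @ replicate s 0) m"
    using i j unfolding kij
    by (auto simp: idx_set_def incr_lists_def mono_of_append mono_of_replicate_0 sorted_wrt_append)
qed

lemma append_image_disjoint:
  assumes "i \<in> idx_set a m" "i' \<in> idx_set a m" "i \<noteq> i'"
  shows "(@) i ` A \<inter> (@) i' ` B = {}"
  using assms by (auto simp: idx_set_def)

lemma incr_lists_0 [simp]: "incr_lists 0 n = {[]}"
  by (auto simp: incr_lists_def)

lemma incr_lists_Suc:
  "bij_betw (\<lambda>(x, j). x # j) (Sigma {n<..} (incr_lists s)) (incr_lists (Suc s) n)"
proof (rule bij_betw_imageI)
  show "(\<lambda>(x, j). x # j) ` Sigma {n<..} (incr_lists s) = incr_lists (Suc s) n"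
  proof (intro equalityI subsetI)
    fix k assume "k \<in> incr_lists (Suc s) n"
    then show "k \<in> (\<lambda>(x, j). x # j) ` Sigma {n<..} (incr_lists s)"
      by (cases k) (auto simp: incr_lists_def image_iff)
  qed (fastforce simp: incr_lists_def)
qed (auto simp: inj_on_def)

section \<open>The regularized sums\<close>

lemma has_sum_geometric_from:
  fixes c :: "'a::{real_normed_field, banach}"
  assumes "norm c < 1"
  shows "((\<lambda>j. c ^ j) has_sum (c ^ Suc n / (1 - c))) {n<..}"
proof -
  have "((\<lambda>j. c ^ j) has_sum (1 / (1 - c))) UNIV"
    by (rule norm_summable_imp_has_sum)
       (use assms in \<open>auto simp: norm_power intro: geometric_sums summable_geometric\<close>)
  then have "((\<lambda>j. c ^ Suc n * c ^ j) has_sum (c ^ Suc n * (1 / (1 - c)))) UNIV"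
    by (rule has_sum_cmult_right)
  then have "((\<lambda>j. c ^ (Suc n + j)) has_sum (c ^ Suc n / (1 - c))) UNIV"
    by (simp only: power_add times_divide_eq_right mult_1_right)
  moreover have "bij_betw (\<lambda>j. Suc n + j) UNIV {n<..}"
    by (rule bij_betwI[of _ _ _ "\<lambda>j. j - Suc n"]) auto
  ultimately show ?thesis by (subst (asm) has_sum_reindex_bij_betw)
qed

text \<open>The closed form of \<open>tail\<close> with a number \<open>q\<close> in place of
  \<open>e^z\<close> and the factor \<open>e^(s t z)\<close> left out.\<close>

definition tail_val :: "'a::field \<Rightarrow> nat \<Rightarrow> nat \<Rightarrow> 'a" where
  "tail_val q n s = q ^ (s * n) * (\<Prod>l=1..s. q ^ l / (1 - q ^ l))"

text \<open>Once the remaining indices are summed, the smallest index \<open>x\<close> runs through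
  a geometric series of ratio \<open>q^(s+1)\<close>. Summability of the double family is assumed
  because its reason differs: nonnegativity for real \<open>q\<close>, absolute convergence for
  complex \<open>q\<close>.\<close>

lemma has_sum_tail_val_step:
  fixes q :: "'a::{real_normed_field, banach}"
  assumes q: "norm q < 1"
    and IH: "\<And>n. ((\<lambda>j. q ^ sum_list j) has_sum tail_val q n s) (incr_lists s n)"
    and summable: "((\<lambda>x. q ^ x * tail_val q x s) summable_on {n<..}) \<Longrightarrow>
      (\<lambda>(x, j). q ^ x * q ^ sum_list j) summable_on Sigma {n<..} (incr_lists s)"
  shows "((\<lambda>j. q ^ sum_list j) has_sum tail_val q n (Suc s)) (incr_lists (Suc s) n)"
proof -
  let ?K = "\<Prod>l=1..s. q ^ l / (1 - q ^ l)"
  have "norm (q ^ Suc s) < 1"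
    unfolding norm_power using q by (simp add: power_less_one_iff del: power_Suc)
  from has_sum_cmult_left[OF has_sum_geometric_from[OF this, of n], of ?K]
  have "((\<lambda>x. (q ^ Suc s) ^ x * ?K) has_sum ((q ^ Suc s) ^ Suc n / (1 - q ^ Suc s) * ?K)) {n<..}" .
  also have "(\<lambda>x. (q ^ Suc s) ^ x * ?K) = (\<lambda>x. q ^ x * tail_val q x s)"
    by (simp add: tail_val_def power_add power_mult fun_eq_iff power_mult_distrib)
  also have "(q ^ Suc s) ^ Suc n / (1 - q ^ Suc s) * ?K = tail_val q n (Suc s)"
    by (simp add: tail_val_def power_add power_mult power_mult_distrib)
  finally have outer: "((\<lambda>x. q ^ x * tail_val q x s) has_sum tail_val q n (Suc s)) {n<..}" .
  have "((\<lambda>(x, j). q ^ x * q ^ sum_list j) has_sum tail_val q n (Suc s)) (Sigma {n<..} (incr_lists s))"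
    by (rule has_sum_SigmaI[OF _ outer summable[OF has_sum_imp_summable[OF outer]]])
       (simp add: has_sum_cmult_right[OF IH])
  then show ?thesis
    by (subst has_sum_reindex_bij_betw[OF incr_lists_Suc, symmetric])
       (simp add: case_prod_unfold power_add)
qed

lemma has_sum_tail_val_real:
  fixes r :: real
  assumes "0 \<le> r" "r < 1"
  shows "((\<lambda>j. r ^ sum_list j) has_sum tail_val r n s) (incr_lists s n)"
proof (induction s arbitrary: n)
  case 0
  show ?case by (rule has_sum_finiteI) (auto simp: tail_val_def)
next
  case (Suc s)
  show ?case
  proof (rule has_sum_tail_val_step)
    assume "(\<lambda>x. r ^ x * tail_val r x s) summable_on {n<..}"
    then show "(\<lambda>(x, j). r ^ x * r ^ sum_list j) summable_on Sigma {n<..} (incr_lists s)"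
      by (rule summable_on_SigmaI[rotated]) (use assms Suc in \<open>auto intro: has_sum_cmult_right\<close>)
  qed (use assms Suc in auto)
qed

lemma has_sum_tail_val:
  fixes q :: complex
  assumes "norm q < 1"
  shows "((\<lambda>j. q ^ sum_list j) has_sum tail_val q n s) (incr_lists s n)"
proof (induction s arbitrary: n)
  case 0
  show ?case by (rule has_sum_finiteI) (auto simp: tail_val_def)
next
  case (Suc s)
  show ?case
  proof (rule has_sum_tail_val_step)
    \<comment> \<open>The absolute values of the terms form the real series at
      \<open>norm q\<close>.\<close>
    have "(\<lambda>j. norm q ^ sum_list j) summable_on incr_lists (Suc s) n"
      using has_sum_tail_val_real[of "norm q" "Suc s" n] assms by (auto intro: has_sum_imp_summable)
    then have "(\<lambda>j. q ^ sum_list j) summable_on incr_lists (Suc s) n"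
      by (simp add: abs_summable_summable norm_power)
    then show "(\<lambda>(x, j). q ^ x * q ^ sum_list j) summable_on Sigma {n<..} (incr_lists s)"
      by (subst (asm) summable_on_reindex_bij_betw[OF incr_lists_Suc, symmetric])
         (simp add: case_prod_unfold power_add)
  qed (use assms Suc in auto)
qed

section \<open>Regularization with all \<open>\<beta>\<close> equal to 1 and its Laurent
  expansion\<close>

definition unit_cols :: "nat list \<Rightarrow> (nat \<times> nat) list" where
  "unit_cols a = map (\<lambda>x. (x, 1)) a"

lemma unit_cols_simps [simp]:
  "length (unit_cols a) = length a" "map fst (unit_cols a) = a" "unit_cols [] = []"
  "take n (unit_cols a) = unit_cols (take n a)" "drop n (unit_cols a) = unit_cols (drop n a)"
  "unit_cols a = [] \<longleftrightarrow> a = []"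
  by (simp_all add: unit_cols_def comp_def take_map drop_map)

text \<open>The contribution of the head \<open>a\<close>; for left weak \<open>a\<close> it is a
  finite sum of exponentials, regular at \<open>z = 0\<close>.\<close>

definition core_fls :: "complex \<Rightarrow> nat list \<Rightarrow> monom \<Rightarrow> complex fls" where
  "core_fls t a m = (\<Sum>i\<in>idx_set a m. expz (of_nat (sum_list i) + of_nat (length a) * t))"

text \<open>The range of the tail indices depends on \<open>m\<close> alone, so the sum factors into
  a finite head sum and a tail sum in \<open>q = exp z\<close>, where \<open>Re z < 0\<close> gives
  \<open>norm q < 1\<close>.\<close>

lemma phi_fun_unit_cols:
  assumes a: "a = [] \<or> last a \<noteq> 0" and z: "Re z < 0"
  shows "phi_fun t (unit_cols (a @ replicate s 0)) m z =
    (\<Sum>i\<in>idx_set a m. exp ((of_nat (sum_list i) + of_nat (length a) * complex_of_real t) * z)) *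
    (exp (of_nat s * (complex_of_real t + of_nat (top_var m)) * z) * (\<Prod>l=1..s. exp (of_nat l * z) / (1 - exp (of_nat l * z))))"
proof -
  let ?n = "top_var m" and ?q = "exp z" and ?a = "a @ replicate s 0"
  let ?f = "\<lambda>i. exp (\<Sum>l<length (unit_cols ?a). (of_nat (i ! l) + complex_of_real t) * of_nat (snd (unit_cols ?a ! l)) * z)"
  define c where "c i = exp ((of_nat (sum_list i) + of_nat (length a) * complex_of_real t) * z)" for i
  define d where "d = exp (of_nat s * complex_of_real t * z)"
  have f: "?f (i @ j) = c i * (d * ?q ^ sum_list j)" if "i \<in> idx_set a m" "j \<in> incr_lists s ?n" for i j
  proof -
    have len: "length (i @ j) = length ?a" using that by (auto simp: idx_set_def incr_lists_def)
    have "(\<Sum>l<length (unit_cols ?a). (of_nat ((i @ j) ! l) + complex_of_real t) * of_nat (snd (unit_cols ?a ! l)) * z)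
       = (\<Sum>l<length ?a. (of_nat ((i @ j) ! l) + complex_of_real t) * z)"
      by (intro sum.cong) (auto simp: unit_cols_def simp del: map_append)
    also have "\<dots> = ((\<Sum>l<length (i @ j). of_nat ((i @ j) ! l)) + of_nat (length ?a) * complex_of_real t) * z"
      unfolding len by (simp add: sum.distrib flip: sum_distrib_right del: length_append)
    also have "(\<Sum>l<length (i @ j). of_nat ((i @ j) ! l)) = (of_nat (sum_list (i @ j)) :: complex)"
      by (simp only: sum_list_sum_nth of_nat_sum atLeast0LessThan)
    finally have "?f (i @ j) = exp ((of_nat (sum_list (i @ j)) + of_nat (length ?a) * complex_of_real t) * z)" by simp
    also have "\<dots> = c i * (d * ?q ^ sum_list j)"
      by (simp add: c_def d_def algebra_simps flip: exp_of_nat_mult exp_add)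
    finally show ?thesis .
  qed
  have "((?f) has_sum (\<Sum>i\<in>idx_set a m. c i * (d * tail_val ?q ?n s))) (idx_set ?a m)"
    unfolding idx_set_append_zeros[OF a]
  proof (rule sum_has_sum)
    fix i assume i: "i \<in> idx_set a m"
    have "((\<lambda>j. ?q ^ sum_list j) has_sum tail_val ?q ?n s) (incr_lists s ?n)"
      by (rule has_sum_tail_val) (use z in simp)
    then have "((\<lambda>j. c i * (d * ?q ^ sum_list j)) has_sum (c i * (d * tail_val ?q ?n s))) (incr_lists s ?n)"
      by (intro has_sum_cmult_right)
    then have "((\<lambda>j. ?f (i @ j)) has_sum (c i * (d * tail_val ?q ?n s))) (incr_lists s ?n)"
      by (subst has_sum_cong[OF f[OF i]])
    then show "(?f has_sum (c i * (d * tail_val ?q ?n s))) ((@) i ` incr_lists s ?n)"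
      by (subst has_sum_reindex) (auto simp: inj_on_def comp_def)
  qed (use append_image_disjoint finite_idx_set[OF a] in \<open>blast+\<close>)
  then have "infsum ?f (idx_set ?a m) = (\<Sum>i\<in>idx_set a m. c i * (d * tail_val ?q ?n s))"
    by (rule infsumI)
  moreover have "d * tail_val ?q ?n s = exp (of_nat s * (complex_of_real t + of_nat ?n) * z) * (\<Prod>l=1..s. exp (of_nat l * z) / (1 - exp (of_nat l * z)))"
  proof -
    have "d * ?q ^ (s * ?n) = exp (of_nat s * (complex_of_real t + of_nat ?n) * z)"
      by (simp add: d_def algebra_simps flip: exp_of_nat_mult exp_add)
    moreover have "exp (of_nat l * z) = ?q ^ l" for l by (simp add: exp_of_nat_mult)
    ultimately show ?thesis unfolding tail_val_def by (simp flip: mult.assoc)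
  qed
  ultimately show ?thesis
    by (simp add: phi_fun_def c_def sum_distrib_right)
qed

lemma expz_laurent: "(\<lambda>z. exp (c * z)) has_laurent_expansion expz c"
  unfolding expz_def by (intro has_laurent_expansion_fps has_fps_expansion_exp)

text \<open>Uniqueness of the expansion is the identity theorem: the half-plane
  \<open>Re z < 0\<close> accumulates at 0, so a Laurent series vanishing on it near 0 is
  zero.\<close>

lemma phi_eqI:
  assumes f: "f has_laurent_expansion F" and eq: "\<And>z. Re z < 0 \<Longrightarrow> phi_fun t ab m z = f z"
  shows "phi t ab m = F"
  unfolding phi_def
proof (rule the_equality)
  have F: "0 < fls_conv_radius F" "\<forall>\<^sub>F z in at 0. eval_fls F z = f z"
    using f by (auto simp: has_laurent_expansion_def)
  show "0 < fls_conv_radius F \<and> (\<forall>\<^sub>F z in at 0. Re z < 0 \<longrightarrow> eval_fls F z = phi_fun t ab m z)"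
    using F(1) eventually_mono[OF F(2)] by (simp add: eq)
  fix G assume G: "0 < fls_conv_radius G \<and> (\<forall>\<^sub>F z in at 0. Re z < 0 \<longrightarrow> eval_fls G z = phi_fun t ab m z)"
  have "(\<lambda>z. eval_fls G z - f z) has_laurent_expansion G - F"
    using G f by (intro has_laurent_expansion_diff) (auto simp: has_laurent_expansion_def)
  then have "(\<lambda>w. (\<lambda>z. eval_fls G z - f z) (0 + w)) has_laurent_expansion G - F" by simp
  from has_laurent_expansion_frequently_zero_iff[OF this]
  have iff: "(\<exists>\<^sub>F z in at 0. eval_fls G z - f z = 0) \<longleftrightarrow> G - F = 0" .
  have "\<exists>\<^sub>F z in at (0::complex). Re z < 0"
    unfolding frequently_at
  proof (intro allI impI)
    fix e :: real assume "e > 0"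
    then show "\<exists>z\<in>UNIV. z \<noteq> 0 \<and> dist z (0::complex) < e \<and> Re z < 0"
      by (intro bexI[of _ "of_real (- e / 2)"]) auto
  qed
  moreover have "\<forall>\<^sub>F z in at 0. Re z < 0 \<longrightarrow> eval_fls G z - f z = 0"
    using G by (auto elim!: eventually_mono simp: eq)
  ultimately have "\<exists>\<^sub>F z in at 0. eval_fls G z - f z = 0"
    by (rule frequently_rev_mp)
  then show "G = F" using iff by simp
qed

lemma phi_unit_cols:
  assumes "a = [] \<or> last a \<noteq> 0"
  shows "phi t (unit_cols (a @ replicate s 0)) m = core_fls t a m * tail t (top_var m) s"
proof (rule phi_eqI[OF _ phi_fun_unit_cols[OF assms]])
  show "(\<lambda>z. (\<Sum>i\<in>idx_set a m. exp ((of_nat (sum_list i) + of_nat (length a) * complex_of_real t) * z)) *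
    (exp (of_nat s * (complex_of_real t + of_nat (top_var m)) * z) * (\<Prod>l=1..s. exp (of_nat l * z) / (1 - exp (of_nat l * z)))))
     has_laurent_expansion core_fls t a m * tail t (top_var m) s"
    unfolding core_fls_def tail_def by (intro laurent_expansion_intros expz_laurent)
qed

section \<open>The renormalized values\<close>

lemma finite_monom_le: "finite {m' :: monom. \<forall>x. Poly_Mapping.lookup m' x \<le> Poly_Mapping.lookup m x}"
proof (rule finite_imageD)
  let ?B = "\<Union>x\<in>Poly_Mapping.keys m. {..Poly_Mapping.lookup m x}"
  show "finite (Poly_Mapping.lookup ` {m' :: monom. \<forall>x. Poly_Mapping.lookup m' x \<le> Poly_Mapping.lookup m x})"
  proof (rule finite_subset)
    show "finite {f. \<forall>x. (x \<in> Poly_Mapping.keys m \<longrightarrow> f x \<in> ?B) \<and> (x \<notin> Poly_Mapping.keys m \<longrightarrow> f x = 0)}"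
      by (rule finite_set_of_finite_funs) auto
    show "Poly_Mapping.lookup ` {m' :: monom. \<forall>x. Poly_Mapping.lookup m' x \<le> Poly_Mapping.lookup m x}
      \<subseteq> {f. \<forall>x. (x \<in> Poly_Mapping.keys m \<longrightarrow> f x \<in> ?B) \<and> (x \<notin> Poly_Mapping.keys m \<longrightarrow> f x = 0)}"
    proof safe
      fix m' :: monom and x assume "\<forall>x. Poly_Mapping.lookup m' x \<le> Poly_Mapping.lookup m x"
      then have le: "Poly_Mapping.lookup m' x \<le> Poly_Mapping.lookup m x" by blast
      { assume "x \<in> Poly_Mapping.keys m" then show "Poly_Mapping.lookup m' x \<in> ?B" using le by blast }
      { assume "x \<notin> Poly_Mapping.keys m" then show "Poly_Mapping.lookup m' x = 0" using le by (simp add: in_keys_iff) }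
    qed
  qed
qed (auto simp: inj_on_def poly_mapping_eqI)

text \<open>Makes the sum in \<open>ser_mult\<close> a genuine convolution; over an infinite index
  set it would be 0 by convention.\<close>

lemma finite_monom_splits: "finite {(m1, m2). m1 + m2 = (m :: monom)}"
proof (rule finite_subset)
  let ?D = "{m' :: monom. \<forall>x. Poly_Mapping.lookup m' x \<le> Poly_Mapping.lookup m x}"
  show "{(m1, m2). m1 + m2 = m} \<subseteq> ?D \<times> ?D" by (auto simp: lookup_add)
qed (simp add: finite_monom_le)

text \<open>For the counterterms, which turn out to be constant in \<open>X\<close>: multiplication
  by them only scales coefficients.\<close>

lemma ser_mult_concentrated:
  assumes "\<And>m. m \<noteq> 0 \<Longrightarrow> g m = 0"
  shows "ser_mult f g m = f m * g 0"
proof -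
  have *: "g m \<noteq> 0 \<Longrightarrow> m = 0" for m using assms by blast
  have "ser_mult f g m = (\<Sum>p\<in>{(m, 0)}. f (fst p) * g (snd p))"
    unfolding ser_mult_def
    by (rule sum.mono_neutral_right) (auto simp: finite_monom_splits dest: *)
  then show ?thesis by simp
qed

lemma trailing_zeros_decomp:
  obtains a' s where "a = a' @ replicate s (0::nat)" "a' = [] \<or> last a' \<noteq> 0"
proof (induction a arbitrary: thesis rule: rev_induct)
  case Nil
  then show ?case by (metis append_Nil replicate_0)
next
  case (snoc x a)
  show ?case
  proof (cases "x = 0")
    case True
    obtain a' s where "a = a' @ replicate s 0" "a' = [] \<or> last a' \<noteq> 0" using snoc.IH by blast
    then show ?thesis using True by (intro snoc.prems[of a' "Suc s"]) (auto simp: replicate_append_same)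
  next
    case False
    then show ?thesis by (intro snoc.prems[of "a @ [x]" 0]) auto
  qed
qed

section \<open>Counterterms and renormalized values\<close>

lemma phi_minus_renE: "phi_minus t ab = (if ab = [] then ser_one else (\<lambda>m. - polar (renE t ab) m))"
proof -
  have "(\<lambda>m. phi t ab m + sum_list (map (\<lambda>i. ser_mult (phi t (take i ab))
          (phi_minus t (drop i ab)) m) [1..<length ab])) = renE t ab"
    by (simp add: renE_def fun_eq_iff)
  then show ?thesis by (subst phi_minus.simps) (simp only:)
qed

declare phi_minus.simps [simp del]

text \<open>Only words of zeros have a counterterm, and it is constant in \<open>X\<close>. Stated
  as a predicate so that it can serve as induction hypothesis for shorter words.\<close>

definition phi_minus_spec :: "real \<Rightarrow> nat list \<Rightarrow> nat \<Rightarrow> bool" where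
  "phi_minus_spec t a s \<longleftrightarrow> (\<forall>m. phi_minus t (unit_cols (a @ replicate s 0)) m =
     (if a = [] \<and> m = 0 then fps_nth (counter_gf t) s else 0))"

text \<open>Only cuts among the trailing zeros contribute, and they form the Cauchy product of
  \<open>T_n\<close> with the counterterm series.\<close>

lemma renE_unit_cols:
  assumes a: "a = [] \<or> last a \<noteq> 0" and ne: "a @ replicate s 0 \<noteq> []"
    and IH: "\<And>b r. b = [] \<or> last b \<noteq> 0 \<Longrightarrow> length b + r < length a + s \<Longrightarrow> phi_minus_spec t b r"
  shows "renE t (unit_cols (a @ replicate s 0)) m =
    core_fls t a m * (fps_nth (tail_gf t (top_var m) * counter_gf t) s
       - (if a = [] then fps_nth (counter_gf t) s else 0))"
proof -
  let ?k = "length a" and ?n = "top_var m" and ?a = "a @ replicate s 0"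
  define C where "C = core_fls t a m"
  define N where "N j = fps_nth (counter_gf t) j" for j
  define g where "g j = tail t ?n j * N (s - j)" for j
  \<comment> \<open>A cut inside \<open>a\<close> leaves a suffix with nonempty head, whose
    counterterm is 0.\<close>
  have short: "ser_mult (phi t (unit_cols (take i ?a))) (phi_minus t (unit_cols (drop i ?a))) m = 0"
    if i: "1 \<le> i" "i < ?k" for i
  proof -
    have "drop i a \<noteq> []" "last (drop i a) \<noteq> 0" using i a by auto
    then have "phi_minus_spec t (drop i a) s" by (intro IH) (use i in auto)
    then have "phi_minus t (unit_cols (drop i ?a)) m' = 0" for m'
      using i by (simp add: phi_minus_spec_def)
    then show ?thesis by (simp add: ser_mult_concentrated)
  qed
  \<comment> \<open>A cut after \<open>a\<close> leaves a word of zeros, whose counterterm is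
    constant in \<open>X\<close>.\<close>
  have long: "ser_mult (phi t (unit_cols (take i ?a))) (phi_minus t (unit_cols (drop i ?a))) m = C * g (i - ?k)"
    if i: "1 \<le> i" "?k \<le> i" "i < ?k + s" for i
  proof -
    have take: "take i ?a = a @ replicate (i - ?k) 0" and drop: "drop i ?a = [] @ replicate (s - (i - ?k)) 0"
      using i by (auto simp: min_def)
    have "phi_minus_spec t [] (s - (i - ?k))" by (intro IH) (use i in auto)
    then show ?thesis
      unfolding take drop by (subst ser_mult_concentrated)
        (simp_all only: phi_minus_spec_def phi_unit_cols[OF a], simp_all add: C_def g_def N_def)
  qed
  have "renE t (unit_cols ?a) m = C * tail t ?n s +
     (\<Sum>i\<in>{1..<?k + s}. ser_mult (phi t (unit_cols (take i ?a))) (phi_minus t (unit_cols (drop i ?a))) m)"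
    unfolding renE_def phi_unit_cols[OF a] unit_cols_simps
    by (simp add: interv_sum_list_conv_sum_set_nat C_def del: take_append drop_append)
  also have "(\<Sum>i\<in>{1..<?k + s}. ser_mult (phi t (unit_cols (take i ?a))) (phi_minus t (unit_cols (drop i ?a))) m)
     = (\<Sum>i\<in>{max 1 ?k..<?k + s}. C * g (i - ?k))"
  proof (rule sum.mono_neutral_cong_right)
    show "\<forall>i\<in>{1..<?k + s} - {max 1 ?k..<?k + s}.
       ser_mult (phi t (unit_cols (take i ?a))) (phi_minus t (unit_cols (drop i ?a))) m = 0"
    proof
      fix i assume "i \<in> {1..<?k + s} - {max 1 ?k..<?k + s}"
      then have "1 \<le> i" "i < ?k" by auto
      then show "ser_mult (phi t (unit_cols (take i ?a))) (phi_minus t (unit_cols (drop i ?a))) m = 0"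
        by (rule short)
    qed
    fix i assume "i \<in> {max 1 ?k..<?k + s}"
    then have "1 \<le> i" "?k \<le> i" "i < ?k + s" by auto
    then show "ser_mult (phi t (unit_cols (take i ?a))) (phi_minus t (unit_cols (drop i ?a))) m = C * g (i - ?k)"
      by (rule long)
  qed auto
  also have "\<dots> = C * (\<Sum>i\<in>{max 1 ?k..<?k + s}. g (i - ?k))" by (simp add: sum_distrib_left)
  \<comment> \<open>Cuts begin at position 1, so for empty \<open>a\<close> the term
    \<open>j = 0\<close>, equal to \<open>N s\<close>, is absent.\<close>
  also have "(\<Sum>i\<in>{max 1 ?k..<?k + s}. g (i - ?k)) = (\<Sum>j\<in>{0..<s}. g j) - (if a = [] then N s else 0)"
  proof (cases "a = []")
    case True
    then have "s > 0" using ne by simp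
    then have "(\<Sum>j\<in>{0..<s}. g j) = g 0 + (\<Sum>j\<in>{1..<s}. g j)"
      by (simp add: sum.atLeast_Suc_lessThan)
    then show ?thesis using True by (simp add: g_def)
  next
    case False
    then have "max 1 ?k = ?k" by (cases a) auto
    then have "(\<Sum>i\<in>{max 1 ?k..<?k + s}. g (i - ?k)) = (\<Sum>j\<in>{0..<s}. g j)"
      using sum.shift_bounds_nat_ivl[of "\<lambda>i. g (i - ?k)" 0 ?k s] by (simp add: add.commute)
    then show ?thesis using False by simp
  qed
  \<comment> \<open>The uncut word supplies the missing term \<open>j = s\<close>, since
    \<open>N 0 = 1\<close>.\<close>
  also have "C * tail t ?n s + C * ((\<Sum>j\<in>{0..<s}. g j) - (if a = [] then N s else 0))
    = C * ((\<Sum>j\<in>{0..s}. g j) - (if a = [] then N s else 0))"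
    by (simp add: atLeastLessThanSuc_atLeastAtMost [symmetric] g_def N_def algebra_simps)
  also have "(\<Sum>j\<in>{0..s}. g j) = fps_nth (tail_gf t ?n * counter_gf t) s"
    by (simp add: fps_mult_nth g_def N_def tail_gf_def)
  finally show ?thesis by (simp add: C_def N_def)
qed

lemma core_fls_regular: "core_fls t a m \<in> regular_fls"
  unfolding core_fls_def by (intro regular_fls_sum expz_regular)

lemma core_fls_nth_0: "fls_nth (core_fls t a m) 0 = of_nat (card (idx_set a m))"
  by (simp add: core_fls_def fls_nth_sum)

lemma idx_set_Nil: "idx_set [] m = (if m = 0 then {[]} else {})"
  by (auto simp: idx_set_def)

lemma core_fls_Nil: "core_fls t [] m = (if m = 0 then 1 else 0)"
  by (simp add: core_fls_def idx_set_Nil)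

lemma top_var_0 [simp]: "top_var 0 = 0"
  by (simp add: top_var_def)

text \<open>For a nonempty head \<open>renE\<close> is already regular. For zeros at
  \<open>m = 0\<close> it is a regular series minus the polar series \<open>counter_gf\<close>, so
  minus its polar part is exactly that coefficient.\<close>

lemma phi_minus_unit_cols:
  assumes "a = [] \<or> last a \<noteq> 0"
  shows "phi_minus_spec t a s"
  using assms
proof (induction "length a + s" arbitrary: a s rule: less_induct)
  case less
  show ?case
  proof (cases "a @ replicate s 0 = []")
    case True
    then show ?thesis by (auto simp: phi_minus_spec_def phi_minus_renE ser_one_def)
  next
    case False
    have E: "renE t (unit_cols (a @ replicate s 0)) m =
      core_fls t a m * (fps_nth (tail_gf t (top_var m) * counter_gf t) s
         - (if a = [] then fps_nth (counter_gf t) s else 0))" for m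
      by (rule renE_unit_cols[OF less.prems False]) (use less.hyps in blast)
    have minus: "phi_minus t (unit_cols (a @ replicate s 0)) m = - polar (renE t (unit_cols (a @ replicate s 0))) m" for m
      using False by (subst phi_minus_renE) auto
    show ?thesis
    proof (cases "a = []")
      case True
      then obtain r where s: "s = Suc r" using False by (cases s) auto
      have "fls_regpart (fps_nth (counter_gf t) s) = 0"
        using counter_gf_polar by (auto simp: s polar_fls_def)
      moreover have "fps_to_fls (fls_regpart (fps_nth (tail_gf t 0 * counter_gf t) s)) = fps_nth (tail_gf t 0 * counter_gf t) s"
        using ren_tail[of t 0 s] by (auto simp: regular_fls_iff)
      ultimately show ?thesis
        unfolding phi_minus_spec_def minus polar_def E using True by (auto simp: core_fls_Nil)
    next
      case False
      have "renE t (unit_cols (a @ replicate s 0)) m \<in> regular_fls" for m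
        unfolding E using False ren_tail by (auto intro!: regular_fls_closed core_fls_regular)
      then show ?thesis
        unfolding phi_minus_spec_def minus polar_def using False by (auto simp: regular_fls_iff)
    qed
  qed
qed

lemma Zval_unit_cols:
  assumes a: "a = [] \<or> last a \<noteq> 0"
  shows "Zval t (unit_cols (a @ replicate s 0)) m =
    of_nat (card (idx_set a m)) * ((- of_real t - 1 / 2 - of_nat (top_var m)) gchoose s)"
proof -
  \<comment> \<open>Removing the polar part leaves the coefficient of \<open>z^0\<close>
    unchanged.\<close>
  have Z: "Zval t ab m = fls_nth (renE t ab m) 0" for ab
    by (simp add: Zval_def phi_plus_def polar_def)
  show ?thesis
  proof (cases "a @ replicate s 0 = []")
    case True
    then have "renE t (unit_cols (a @ replicate s 0)) m = core_fls t [] m * tail t (top_var m) 0"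
      using phi_unit_cols[of "[]" t 0 m] by (simp add: renE_def)
    then show ?thesis unfolding Z using True by (simp add: core_fls_Nil idx_set_Nil)
  next
    case False
    have E: "renE t (unit_cols (a @ replicate s 0)) m =
      core_fls t a m * (fps_nth (tail_gf t (top_var m) * counter_gf t) s
         - (if a = [] then fps_nth (counter_gf t) s else 0))"
      by (rule renE_unit_cols[OF a False phi_minus_unit_cols])
    \<comment> \<open>For empty \<open>a\<close> the word has \<open>s > 0\<close> zeros, so the
      subtracted counterterm is purely polar and does not affect the constant term.\<close>
    have "fls_nth (if a = [] then core_fls t a m * fps_nth (counter_gf t) s else 0) 0 = 0"
    proof (cases "a = []")
      case True
      then obtain r where s: "s = Suc r" using False by (cases s) auto
      show ?thesis using counter_gf_polar[of t r] by (auto simp: True core_fls_Nil s polar_fls_iff)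
    qed simp
    moreover have "renE t (unit_cols (a @ replicate s 0)) m =
      core_fls t a m * fps_nth (tail_gf t (top_var m) * counter_gf t) s
         - (if a = [] then core_fls t a m * fps_nth (counter_gf t) s else 0)"
      by (simp add: E right_diff_distrib)
    ultimately show ?thesis
      unfolding Z using ren_tail[of t "top_var m" s]
      by (simp add: regular_fls_mult_nth_0 core_fls_regular core_fls_nth_0)
  qed
qed

section \<open>The coefficient polynomials\<close>

lemma map_poly_of_rat_mult:
  "map_poly of_rat (p * q) = (map_poly of_rat p * map_poly of_rat q :: 'a::field_char_0 poly)"
  by (rule poly_eqI) (simp add: coeff_map_poly coeff_mult of_rat_sum of_rat_mult)

lemma poly_map_poly_of_rat:
  "poly (map_poly of_rat p) (of_rat x :: 'a::field_char_0) = of_rat (poly p x)"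
  by (induction p) (simp_all add: map_poly_pCons of_rat_add of_rat_mult)

lemma poly_eq_if_infinite:
  fixes p q :: "'a::{comm_ring_1, ring_no_zero_divisors} poly"
  assumes "\<And>n::nat. poly p (f n) = poly q (f n)" "inj f"
  shows "p = q"
proof (rule ccontr)
  assume "p \<noteq> q"
  then have "finite {x. poly (p - q) x = 0}" by (intro poly_roots_finite) simp
  moreover have "range f \<subseteq> {x. poly (p - q) x = 0}" using assms by auto
  ultimately show False using range_inj_infinite[OF assms(2)] finite_subset by blast
qed

definition gchoose_poly :: "nat \<Rightarrow> nat \<Rightarrow> rat poly" where
  "gchoose_poly n s = smult (1 / fact s) (\<Prod>i=0..<s. [:- 1 / 2 - of_nat n - of_nat i, - 1:])"

lemma poly_gchoose_poly:
  "poly (map_poly of_rat (gchoose_poly n s)) x = (- x - 1 / 2 - of_nat n) gchoose s"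
  for x :: "'a::field_char_0"
proof -
  have "poly (map_poly of_rat (\<Prod>i=0..<s. [:- 1 / 2 - of_nat n - of_nat i, - 1:])) x =
     (\<Prod>i=0..<s. - x - 1 / 2 - of_nat n - of_nat i)"
  proof -
    have "poly (map_poly of_rat (\<Prod>i\<in>A. f i)) x = (\<Prod>i\<in>A. poly (map_poly of_rat (f i)) x)"
      for f :: "nat \<Rightarrow> rat poly" and A
      by (induction A rule: infinite_finite_induct) (simp_all add: map_poly_of_rat_mult)
    then show ?thesis
      by (simp add: map_poly_pCons of_rat_add of_rat_diff of_rat_minus of_rat_divide algebra_simps)
  qed
  moreover have "of_rat (fact s) = (fact s :: 'a)" by (metis of_nat_fact of_rat_of_nat_eq)
  ultimately show ?thesis
    by (simp add: gchoose_poly_def map_poly_smult of_rat_mult of_rat_divide gbinomial_prod_rev)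
qed

lemma Mrat_eq:
  assumes a: "a = [] \<or> last a \<noteq> 0"
  shows "Mrat (a @ replicate s 0) m = smult (of_nat (card (idx_set a m))) (gchoose_poly (top_var m) s)"
  unfolding Mrat_def
proof (rule the_equality)
  let ?p = "smult (of_nat (card (idx_set a m))) (gchoose_poly (top_var m) s)"
  have p: "poly (map_poly of_rat ?p) (complex_of_real t) = Zval t (map (\<lambda>x. (x, 1)) (a @ replicate s 0)) m" for t
    using Zval_unit_cols[OF a, of t s m]
    by (simp add: map_poly_smult of_rat_mult poly_gchoose_poly unit_cols_def)
  show "\<forall>t\<ge>0. poly (map_poly of_rat ?p) (complex_of_real t) = Zval t (map (\<lambda>x. (x, 1)) (a @ replicate s 0)) m"
    using p by blast
  fix p' assume p': "\<forall>t\<ge>0. poly (map_poly of_rat p') (complex_of_real t) = Zval t (map (\<lambda>x. (x, 1)) (a @ replicate s 0)) m"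
  show "p' = ?p"
  \<comment> \<open>At natural \<open>t\<close> both complex values come from rationals, so their
    agreement descends along \<open>of_rat\<close>.\<close>
  proof (rule poly_eq_if_infinite[where f = of_nat])
    fix n :: nat
    have "poly (map_poly of_rat p') (of_rat (of_nat n)) = (poly (map_poly of_rat ?p) (of_rat (of_nat n)) :: complex)"
      using p'[rule_format, of "of_nat n"] p[of "of_nat n"] by simp
    then show "poly p' (of_nat n) = poly ?p (of_nat n)"
      unfolding poly_map_poly_of_rat by simp
  qed (simp add: inj_on_def)
qed

section \<open>Quasisymmetric polynomials in finitely many variables\<close>

definition bincr :: "nat \<Rightarrow> nat \<Rightarrow> nat \<Rightarrow> nat list set" where
  "bincr k p N = {j \<in> incr_lists k p. \<forall>x\<in>set j. x \<le> N}"

lemma finite_bincr [simp]: "finite (bincr k p N)"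
  by (rule finite_subset[OF _ finite_lists_length_eq[of "{..N}" k]]) (auto simp: bincr_def incr_lists_def)

lemma card_bincr: "card (bincr k p N) = (N - p) choose k"
proof -
  have "bij_betw set (bincr k p N) {B. B \<subseteq> {p<..N} \<and> card B = k}"
  proof (rule bij_betwI[of _ _ _ sorted_list_of_set])
    show "set \<in> bincr k p N \<rightarrow> {B. B \<subseteq> {p<..N} \<and> card B = k}"
      by (auto simp: bincr_def incr_lists_def distinct_card dest: strict_sorted_iff[THEN iffD1])
    show "sorted_list_of_set \<in> {B. B \<subseteq> {p<..N} \<and> card B = k} \<rightarrow> bincr k p N"
    proof
      fix B assume B: "B \<in> {B. B \<subseteq> {p<..N} \<and> card B = k}"
      then have "finite B" using finite_subset by blast
      then show "sorted_list_of_set B \<in> bincr k p N"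
        using B by (auto simp: bincr_def incr_lists_def)
    qed
    show "sorted_list_of_set (set j) = j" if "j \<in> bincr k p N" for j
      using that by (auto simp: bincr_def incr_lists_def strict_sorted_iff sorted_list_of_set.idem_if_sorted_distinct)
    show "set (sorted_list_of_set B) = B" if "B \<in> {B. B \<subseteq> {p<..N} \<and> card B = k}" for B
      using that finite_subset[of B "{p<..N}"] by auto
  qed
  then show ?thesis by (simp add: bij_betw_same_card n_subsets)
qed

text \<open>The truncated form of \<open>idx_set_append_zeros\<close>: the head already lies below
  \<open>N\<close>, and the zeros choose \<open>s\<close> of the \<open>N - top_var m\<close>
  remaining indices.\<close>

lemma card_idx_set_bounded:
  assumes a: "a = [] \<or> last a \<noteq> 0" and N: "top_var m \<le> N"
  shows "card {i \<in> idx_set (a @ replicate s 0) m. \<forall>x\<in>set i. x \<le> N}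
     = card (idx_set a m) * ((N - top_var m) choose s)"
proof -
  let ?n = "top_var m"
  have "{i \<in> idx_set (a @ replicate s 0) m. \<forall>x\<in>set i. x \<le> N} = (\<Union>i\<in>idx_set a m. (@) i ` bincr s ?n N)"
    unfolding idx_set_append_zeros[OF a] using idx_set_top[OF _ a] N
    by (fastforce simp: bincr_def)
  also have "card \<dots> = (\<Sum>i\<in>idx_set a m. card ((@) i ` bincr s ?n N))"
    by (rule card_UN_disjoint) (use append_image_disjoint finite_idx_set[OF a] in \<open>auto\<close>)
  also have "\<dots> = (\<Sum>i\<in>idx_set a m. (N - ?n) choose s)"
    by (intro sum.cong refl) (simp add: card_image inj_on_def card_bincr)
  finally show ?thesis by simp
qed

section \<open>Truncated series as polynomials and their quasi-shuffle product\<close>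

definition fin_M :: "nat \<Rightarrow> nat \<Rightarrow> nat list \<Rightarrow> monom \<Rightarrow>\<^sub>0 nat" where
  "fin_M p N a = (\<Sum>i\<in>bincr (length a) p N. Poly_Mapping.single (mono_of i a) 1)"

lemma lookup_sum: "Poly_Mapping.lookup (sum f I) x = (\<Sum>i\<in>I. Poly_Mapping.lookup (f i) x)"
  by (induction I rule: infinite_finite_induct) (simp_all add: lookup_add)

lemma lookup_fin_M:
  "Poly_Mapping.lookup (fin_M 0 N a) m = card {i \<in> idx_set a m. \<forall>x\<in>set i. x \<le> N}"
proof -
  have "Poly_Mapping.lookup (fin_M 0 N a) m = (\<Sum>i\<in>bincr (length a) 0 N. if mono_of i a = m then 1 else 0)"
    unfolding fin_M_def lookup_sum by (intro sum.cong) (auto simp: lookup_single when_def)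
  also have "\<dots> = card {i \<in> bincr (length a) 0 N. mono_of i a = m}"
    by (simp flip: sum.inter_filter)
  also have "{i \<in> bincr (length a) 0 N. mono_of i a = m} = {i \<in> idx_set a m. \<forall>x\<in>set i. x \<le> N}"
    by (auto simp: bincr_def incr_lists_def idx_set_def)
  finally show ?thesis .
qed

text \<open>The coefficient polynomials interpolate the truncations to \<open>N\<close> variables:
  renormalization amounts to setting \<open>N = -t - 1/2\<close>.\<close>
lemma poly_Mrat:
  assumes "top_var m \<le> N"
  shows "poly (Mrat a m) (- 1 / 2 - of_nat N) = of_nat (Poly_Mapping.lookup (fin_M 0 N a) m)"
proof -
  obtain a' s where a: "a = a' @ replicate s 0" and a': "a' = [] \<or> last a' \<noteq> 0"
    by (rule trailing_zeros_decomp)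
  have id: "map_poly of_rat p = p" for p :: "rat poly"
    by (rule poly_eqI) (simp add: coeff_map_poly)
  have "poly (gchoose_poly (top_var m) s) (- 1 / 2 - of_nat N) = of_nat (N - top_var m) gchoose s"
    using poly_gchoose_poly[of "top_var m" s "- 1 / 2 - of_nat N :: rat"] assms by (simp add: id of_nat_diff)
  then show ?thesis
    unfolding a Mrat_eq[OF a'] lookup_fin_M card_idx_set_bounded[OF a' assms]
    by (simp add: binomial_gbinomial)
qed

lemma fin_M_Nil: "fin_M p N [] = 1"
proof -
  have "bincr 0 p N = {[]}" by (auto simp: bincr_def)
  moreover have "Poly_Mapping.single 0 (1::nat) = (1 :: monom \<Rightarrow>\<^sub>0 nat)" by (rule single_one)
  ultimately show ?thesis by (simp add: fin_M_def)
qed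

lemma fin_M_Cons_empty: "N \<le> p \<Longrightarrow> fin_M p N (x # a) = 0"
proof -
  assume "N \<le> p"
  then have "bincr (Suc (length a)) p N = {}" by (auto simp: bincr_def incr_lists_def length_Suc_conv)
  then show ?thesis by (simp add: fin_M_def)
qed

text \<open>Either the variable with index \<open>p + 1\<close> is skipped or it carries the first
  entry. The lower bound \<open>p\<close> is a parameter of \<open>fin_M\<close> so that variables
  can be removed from below.\<close>

lemma fin_M_Cons:
  assumes "p < N"
  shows "fin_M p N (x # a) = fin_M (Suc p) N (x # a)
    + Poly_Mapping.single (Poly_Mapping.single (Suc p) x) 1 * fin_M (Suc p) N a"
proof -
  let ?k = "length a"
  have split: "bincr (Suc ?k) p N = bincr (Suc ?k) (Suc p) N \<union> Cons (Suc p) ` bincr ?k (Suc p) N"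
  proof (intro equalityI subsetI)
    fix i assume i: "i \<in> bincr (Suc ?k) p N"
    then obtain y j where ij: "i = y # j" by (cases i) (auto simp: bincr_def incr_lists_def)
    show "i \<in> bincr (Suc ?k) (Suc p) N \<union> Cons (Suc p) ` bincr ?k (Suc p) N"
    proof (cases "y = Suc p")
      case True
      then show ?thesis using i by (auto simp: ij bincr_def incr_lists_def)
    next
      case False
      then show ?thesis using i by (fastforce simp: ij bincr_def incr_lists_def)
    qed
  next
    fix i assume "i \<in> bincr (Suc ?k) (Suc p) N \<union> Cons (Suc p) ` bincr ?k (Suc p) N"
    then show "i \<in> bincr (Suc ?k) p N"
      using assms by (fastforce simp: bincr_def incr_lists_def)
  qed
  have "fin_M p N (x # a) = (\<Sum>i\<in>bincr (Suc ?k) (Suc p) N. Poly_Mapping.single (mono_of i (x # a)) 1)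
     + (\<Sum>i\<in>Cons (Suc p) ` bincr ?k (Suc p) N. Poly_Mapping.single (mono_of i (x # a)) 1)"
    unfolding fin_M_def list.size(4) add_Suc_right add_0_right split
    by (rule sum.union_disjoint) (simp, simp, auto simp: bincr_def incr_lists_def)
  also have "(\<Sum>i\<in>Cons (Suc p) ` bincr ?k (Suc p) N. Poly_Mapping.single (mono_of i (x # a)) (1::nat))
     = (\<Sum>i\<in>bincr ?k (Suc p) N. Poly_Mapping.single (Poly_Mapping.single (Suc p) x) 1 * Poly_Mapping.single (mono_of i a) 1)"
    by (subst sum.reindex) (auto simp: inj_on_def mult_single)
  finally show ?thesis by (simp add: fin_M_def sum_distrib_left)
qed

text \<open>Induction on the number of variables. Expanding both factors by
  \<open>fin_M_Cons\<close> gives four products: in three of them index \<open>p + 1\<close> is used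
  by the left word, the right word or both, which are the three clauses of \<open>qsh\<close>; the
  fourth is the same product in fewer variables.\<close>

lemma fin_M_mult: "fin_M p N a * fin_M p N b = (\<Sum>c\<in>#qsh a b. fin_M p N c)"
proof (induction "N - p" arbitrary: p a b)
  \<comment> \<open>Without variables every nonempty word gives 0, and two nonempty words have only
    nonempty quasi-shuffles.\<close>
  case 0
  then have "N \<le> p" by simp
  then show ?case
    by (cases "(a, b)" rule: qsh.cases) (simp_all add: fin_M_Nil fin_M_Cons_empty multiset.map_comp comp_def)
next
  case (Suc d)
  then have p: "p < N" and d: "d = N - Suc p" by simp_all
  note IH = Suc.hyps(1)[OF d]
  show ?case
  proof (cases "(a, b)" rule: qsh.cases)
    case (3 x a' y b')
    let ?X = "\<lambda>x. Poly_Mapping.single (Poly_Mapping.single (Suc p) x) (1::nat)"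
    let ?F = "fin_M (Suc p) N"
    have X: "?X x * ?X y = ?X (x + y)" by (simp add: mult_single single_add)
    have "fin_M p N a * fin_M p N b = (?F (x # a') + ?X x * ?F a') * (?F (y # b') + ?X y * ?F b')"
      using 3 by (simp add: fin_M_Cons[OF p])
    also have "\<dots> = ?F (x # a') * ?F (y # b') + ?X x * (?F a' * ?F (y # b'))
        + ?X y * (?F (x # a') * ?F b') + ?X x * ?X y * (?F a' * ?F b')"
      by (simp add: algebra_simps)
    also have "\<dots> = (\<Sum>c\<in>#qsh (x # a') (y # b'). ?F c) + ?X x * (\<Sum>c\<in>#qsh a' (y # b'). ?F c)
        + ?X y * (\<Sum>c\<in>#qsh (x # a') b'. ?F c) + ?X (x + y) * (\<Sum>c\<in>#qsh a' b'. ?F c)"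
      unfolding IH X ..
    also have "\<dots> = (\<Sum>c\<in>#qsh (x # a') (y # b'). fin_M p N c)"
      by (simp add: multiset.map_comp comp_def fin_M_Cons[OF p] sum_mset.distrib sum_mset_distrib_left sum_mset_distrib_right algebra_simps)
    finally show ?thesis using 3 by simp
  qed (simp_all add: fin_M_Nil)
qed

section \<open>The product formula for the coefficient polynomials\<close>

lemma lookup_mult_splits:
  fixes f g :: "monom \<Rightarrow>\<^sub>0 nat"
  shows "Poly_Mapping.lookup (f * g) m =
    (\<Sum>p\<in>{(m1, m2). m1 + m2 = m}. Poly_Mapping.lookup f (fst p) * Poly_Mapping.lookup g (snd p))"
proof -
  let ?S = "{(m1, m2). m1 + m2 = m}"
  let ?f = "Poly_Mapping.lookup f" and ?g = "Poly_Mapping.lookup g"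
  let ?K = "Poly_Mapping.keys f" and ?L = "Poly_Mapping.keys g"
  have "Poly_Mapping.lookup (f * g) m = (\<Sum>l\<in>?K. ?f l * (\<Sum>q\<in>?L. ?g q when m = l + q))"
  proof -
    have inner: "(\<Sum>q. ?g q when m = l + q) = (\<Sum>q\<in>?L. ?g q when m = l + q)" for l
      by (rule Sum_any.expand_superset) (auto simp: in_keys_iff when_def split: if_splits)
    show ?thesis unfolding lookup_mult inner
      by (rule Sum_any.expand_superset) (auto simp: in_keys_iff)
  qed
  also have "\<dots> = (\<Sum>p\<in>?K \<times> ?L. if p \<in> ?S then ?f (fst p) * ?g (snd p) else 0)"
    by (simp add: sum_distrib_left sum.cartesian_product when_def case_prod_unfold if_distrib eq_commute cong: if_cong)
  also have "\<dots> = (\<Sum>p\<in>(?K \<times> ?L) \<inter> ?S. ?f (fst p) * ?g (snd p))"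
    by (simp add: sum.inter_restrict)
  also have "\<dots> = (\<Sum>p\<in>?S. ?f (fst p) * ?g (snd p))"
    by (rule sum.mono_neutral_left) (auto simp: finite_monom_splits in_keys_iff)
  finally show ?thesis .
qed

lemma top_var_leI: "\<forall>x\<in>Poly_Mapping.keys m. x \<le> N \<Longrightarrow> top_var m \<le> N"
  by (auto simp: top_var_def)

lemma top_var_mono:
  assumes "m1 + m2 = m"
  shows "top_var m1 \<le> top_var m" "top_var m2 \<le> top_var m"
proof -
  have "Poly_Mapping.keys m1 \<subseteq> Poly_Mapping.keys m" "Poly_Mapping.keys m2 \<subseteq> Poly_Mapping.keys m"
    using assms by (auto simp: in_keys_iff lookup_add)
  then have "\<forall>x\<in>Poly_Mapping.keys m1. x \<le> top_var m" "\<forall>x\<in>Poly_Mapping.keys m2. x \<le> top_var m"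
    using keys_le_top_var by blast+
  then show "top_var m1 \<le> top_var m" "top_var m2 \<le> top_var m"
    by (simp_all add: top_var_leI)
qed

lemma poly_sum_mset: "poly (\<Sum>c\<in>#A. f c) x = (\<Sum>c\<in>#A. poly (f c) x)"
  by (induction A) simp_all

lemma lookup_sum_mset: "Poly_Mapping.lookup (\<Sum>c\<in>#A. f c) x = (\<Sum>c\<in>#A. Poly_Mapping.lookup (f c) x)"
  by (induction A) (simp_all add: lookup_add)

lemma of_nat_sum_mset: "of_nat (\<Sum>c\<in>#A. f c) = (\<Sum>c\<in>#A. of_nat (f c))"
  by (induction A) simp_all

text \<open>Both sides are polynomials in \<open>t\<close> that agree at every
  \<open>t = -1/2 - N\<close> with \<open>N >= top_var m\<close>, by the formula in \<open>N\<close>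
  variables. The bound on \<open>N\<close> covers all factors of \<open>m\<close> as well.\<close>

lemma Mrat_mult:
  "(\<Sum>p\<in>{(m1, m2). m1 + m2 = m}. Mrat a (fst p) * Mrat b (snd p)) = (\<Sum>c\<in>#qsh a b. Mrat c m)"
proof (rule poly_eq_if_infinite[where f = "\<lambda>n. - 1 / 2 - of_nat (top_var m + n)"])
  fix n :: nat
  define N where "N = top_var m + n"
  let ?x = "- 1 / 2 - of_nat N :: rat"
  have N: "top_var m \<le> N" by (simp add: N_def)
  have "poly (\<Sum>p\<in>{(m1, m2). m1 + m2 = m}. Mrat a (fst p) * Mrat b (snd p)) ?x =
    of_nat (\<Sum>p\<in>{(m1, m2). m1 + m2 = m}. Poly_Mapping.lookup (fin_M 0 N a) (fst p) * Poly_Mapping.lookup (fin_M 0 N b) (snd p))"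
    unfolding poly_sum poly_mult of_nat_sum of_nat_mult
  proof (rule sum.cong)
    fix p :: "monom \<times> monom" assume "p \<in> {(m1, m2). m1 + m2 = m}"
    then have "top_var (fst p) \<le> N" "top_var (snd p) \<le> N"
      using top_var_mono[of "fst p" "snd p" m] N by auto
    then show "poly (Mrat a (fst p)) ?x * poly (Mrat b (snd p)) ?x
       = of_nat (Poly_Mapping.lookup (fin_M 0 N a) (fst p)) * of_nat (Poly_Mapping.lookup (fin_M 0 N b) (snd p))"
      by (simp only: poly_Mrat)
  qed simp
  also have "\<dots> = of_nat (Poly_Mapping.lookup (\<Sum>c\<in>#qsh a b. fin_M 0 N c) m)"
    by (simp only: lookup_mult_splits [symmetric] fin_M_mult)
  also have "\<dots> = poly (\<Sum>c\<in>#qsh a b. Mrat c m) ?x"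
    by (simp only: lookup_sum_mset of_nat_sum_mset poly_sum_mset poly_Mrat[OF N])
  finally show "poly (\<Sum>p\<in>{(m1, m2). m1 + m2 = m}. Mrat a (fst p) * Mrat b (snd p)) (- 1 / 2 - of_nat (top_var m + n))
     = poly (\<Sum>c\<in>#qsh a b. Mrat c m) (- 1 / 2 - of_nat (top_var m + n))"
    unfolding N_def .
qed (simp add: inj_on_def)

text \<open>With \<open>length a\<close> variables, an increasing list at least as long as
  \<open>a\<close> must be \<open>1, ..., length a\<close>; a longer word therefore contributes
  nothing.\<close>

lemma fin_M_triangular:
  assumes "length a \<le> length b"
  shows "Poly_Mapping.lookup (fin_M 0 (length a) b) (mono_of [1..<Suc (length a)] a) = (if a = b then 1 else 0)"
proof -
  let ?N = "length a" and ?m = "mono_of [1..<Suc (length a)] a"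
  have unique: "i = [1..<Suc ?N] \<and> length b = ?N" if i: "i \<in> bincr (length b) 0 ?N" for i
  proof -
    have s: "sorted_wrt (<) i" and sub: "set i \<subseteq> {1..?N}" and len: "length i = length b"
      using i by (auto simp: bincr_def incr_lists_def Suc_le_eq)
    have d: "distinct i" using s by (simp add: strict_sorted_iff)
    have "length b \<le> card {1..?N}" using card_mono[OF _ sub] distinct_card[OF d] len by simp
    then have "length b = ?N" using assms by simp
    then have "set i = {1..?N}" using sub distinct_card[OF d] len by (intro card_subset_eq) auto
    then have "set i = set [1..<Suc ?N]"
      by (simp add: atLeastLessThanSuc_atLeastAtMost del: upt_Suc)
    then have "i = [1..<Suc ?N]"
      using s by (intro strict_sorted_equal) (simp_all del: upt_Suc)
    then show ?thesis using \<open>length b = ?N\<close> by simp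
  qed
  \<comment> \<open>For a fixed list of distinct indices all exponents, zeros included, can be read
    off from the monomial.\<close>
  have inj: "a' = b'" if "length a' = length j" "length b' = length j" "distinct j" "mono_of j a' = mono_of j b'" for a' b' j
    using that
  proof (induction j arbitrary: a' b')
    case (Cons y j)
    obtain x a0 x' b0 where ab: "a' = x # a0" "b' = x' # b0" using Cons.prems by (cases a'; cases b') auto
    have len: "length a0 = length j" "length b0 = length j" using Cons.prems ab by auto
    have "y \<notin> Poly_Mapping.keys (mono_of j a0)" "y \<notin> Poly_Mapping.keys (mono_of j b0)"
      using keys_mono_of[of j a0] keys_mono_of[of j b0] len Cons.prems(3) by auto
    then have 0: "Poly_Mapping.lookup (mono_of j a0) y = 0" "Poly_Mapping.lookup (mono_of j b0) y = 0"
      by (auto simp: in_keys_iff)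
    have eq: "Poly_Mapping.single y x + mono_of j a0 = Poly_Mapping.single y x' + mono_of j b0"
      using Cons.prems(4) ab by simp
    from arg_cong[OF this, of "\<lambda>f. Poly_Mapping.lookup f y"] have "x = x'"
      by (simp add: lookup_add 0)
    then show ?case using eq Cons.IH[of a0 b0] Cons.prems len ab by simp
  qed simp
  have "{i \<in> idx_set b ?m. \<forall>x\<in>set i. x \<le> ?N} = {i \<in> bincr (length b) 0 ?N. mono_of i b = ?m}"
    by (auto simp: bincr_def incr_lists_def idx_set_def)
  also have "\<dots> = (if a = b then {[1..<Suc ?N]} else {})"
  proof (cases "a = b")
    case True
    have "[1..<Suc ?N] \<in> bincr (length b) 0 ?N"
      by (auto simp: True bincr_def incr_lists_def simp del: upt_Suc)
    then have "(i \<in> bincr (length b) 0 ?N \<and> mono_of i b = ?m) = (i = [1..<Suc ?N])" for i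
      using unique[of i] True by metis
    then have "{i \<in> bincr (length b) 0 ?N. mono_of i b = ?m} = {[1..<Suc ?N]}" by blast
    then show ?thesis using True by (simp only: simp_thms if_True)
  next
    case False
    have "\<not> (i \<in> bincr (length b) 0 ?N \<and> mono_of i b = ?m)" for i
    proof
      assume i: "i \<in> bincr (length b) 0 ?N \<and> mono_of i b = ?m"
      then have "i = [1..<Suc ?N]" "length b = ?N" using unique by blast+
      then have "b = a" using i by (intro inj[of b "[1..<Suc ?N]" a]) (auto simp del: upt_Suc)
      then show False using False by simp
    qed
    then show ?thesis using False by (simp del: upt_Suc)
  qed
  finally show ?thesis unfolding lookup_fin_M by (simp del: upt_Suc)
qed

text \<open>Brings this monomial within the range of \<open>poly_Mrat\<close> at
  \<open>N = length a\<close>; the inequality is strict when \<open>a\<close> ends in 0.\<close>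

lemma top_var_interval: "top_var (mono_of [1..<Suc (length a)] a) \<le> length a"
proof -
  have "Poly_Mapping.keys (mono_of [1..<Suc (length a)] a) \<subseteq> set [1..<Suc (length a)]"
    by (rule keys_mono_of) (simp del: upt_Suc)
  then have "\<forall>x\<in>Poly_Mapping.keys (mono_of [1..<Suc (length a)] a). x \<le> length a" by (auto simp del: upt_Suc)
  then show ?thesis by (simp only: top_var_leI)
qed

section \<open>Scalar extension and the isomorphism\<close>

lemma coeff_sum_mset: "coeff (\<Sum>c\<in>#A. f c) j = (\<Sum>c\<in>#A. coeff (f c) j)"
  by (induction A) simp_all

section \<open>The embedding of the rationals into the scalars\<close>

lemma rat_fraction:
  fixes x :: rat
  obtains a b where "x = of_int a / of_int b" "b \<noteq> 0"
  by (metis less_irrefl quotient_of_denom_pos quotient_of_div surj_pair)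

text \<open>Invertibility of the positive integers expresses that the scalars contain the
  rationals.\<close>

context
  assumes containsQ: "\<forall>n::nat. 0 < n \<longrightarrow> (\<exists>y::'k::comm_ring_1. of_nat n * y = 1)"
begin

lemma of_int_has_inverse:
  assumes "b \<noteq> 0"
  shows "\<exists>y::'k. of_int b * y = 1"
proof -
  obtain y :: 'k where y: "of_nat (nat \<bar>b\<bar>) * y = 1" using containsQ[rule_format, of "nat \<bar>b\<bar>"] assms by auto
  show ?thesis
  proof (cases "b > 0")
    case True
    then have "of_int b * y = 1" using y by (simp add: of_nat_nat)
    then show ?thesis by blast
  next
    case False
    then have "of_int b * (- y) = 1" using y by (simp add: of_nat_nat)
    then show ?thesis by blast
  qed
qed

lemma of_int_cancel:
  fixes x y :: 'k
  assumes "b \<noteq> 0" "of_int b * x = of_int b * y"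
  shows "x = y"
proof -
  obtain i :: 'k where i: "of_int b * i = 1" using of_int_has_inverse[OF assms(1)] by blast
  have "x = (of_int b * i) * x" using i by simp
  also have "\<dots> = i * (of_int b * x)" by (simp only: mult_ac)
  also have "\<dots> = i * (of_int b * y)" using assms by simp
  also have "\<dots> = (of_int b * i) * y" by (simp only: mult_ac)
  finally show ?thesis using i by simp
qed

text \<open>\<open>ratk\<close> is defined from the reduced fraction; a description through any
  fraction reduces sums and products to clearing denominators.\<close>

lemma ratk_fraction:
  assumes "b \<noteq> 0"
  shows "of_int b * ratk (of_int a / of_int b) = (of_int a :: 'k)"
proof -
  obtain c d where cd: "quotient_of (of_int a / of_int b) = (c, d)" by fastforce
  have d: "d > 0" using cd by (rule quotient_of_denom_pos)
  have "(of_int a / of_int b :: rat) = of_int c / of_int d" using cd by (rule quotient_of_div)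
  then have "of_int (a * d) = (of_int (c * b) :: rat)" using d assms by (simp add: field_simps)
  then have ad: "a * d = c * b" by (simp only: of_int_eq_iff)
  define i :: 'k where "i = (THE y. of_int d * y = 1)"
  have "\<exists>!y::'k. of_int d * y = 1"
    using of_int_has_inverse[of d] of_int_cancel[of d] d by (metis less_irrefl)
  then have i: "of_int d * i = 1" unfolding i_def by (rule theI')
  have "of_int b * ratk (of_int a / of_int b) = of_int (c * b) * i"
    by (simp add: ratk_def cd i_def mult_ac)
  also have "\<dots> = of_int a * (of_int d * i)" by (simp flip: ad)
  finally show ?thesis using i by simp
qed

lemma ratk_add: "ratk (x + y) = (ratk x + ratk y :: 'k)"
proof -
  obtain a b where x: "x = of_int a / of_int b" "b \<noteq> 0" by (rule rat_fraction)
  obtain c d where y: "y = of_int c / of_int d" "d \<noteq> 0" by (rule rat_fraction)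
  have xy: "x + y = of_int (a * d + c * b) / of_int (b * d)" using x y by (simp add: field_simps)
  have "of_int (b * d) * (ratk x + ratk y :: 'k) = of_int d * (of_int b * ratk x) + of_int b * (of_int d * ratk y)"
    by (simp add: algebra_simps)
  also have "\<dots> = of_int (a * d + c * b)"
    using x y by (simp add: ratk_fraction algebra_simps)
  also have "\<dots> = of_int (b * d) * ratk (x + y)"
    unfolding xy by (rule ratk_fraction[symmetric]) (use x y in simp)
  finally show ?thesis using of_int_cancel[of "b * d"] x y by (metis mult_eq_0_iff)
qed

lemma ratk_mult: "ratk (x * y) = (ratk x * ratk y :: 'k)"
proof -
  obtain a b where x: "x = of_int a / of_int b" "b \<noteq> 0" by (rule rat_fraction)
  obtain c d where y: "y = of_int c / of_int d" "d \<noteq> 0" by (rule rat_fraction)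
  have xy: "x * y = of_int (a * c) / of_int (b * d)" using x y by simp
  have "of_int (b * d) * (ratk x * ratk y :: 'k) = (of_int b * ratk x) * (of_int d * ratk y)"
    by (simp add: algebra_simps)
  also have "\<dots> = of_int (a * c)"
    using x y by (simp add: ratk_fraction)
  also have "\<dots> = of_int (b * d) * ratk (x * y)"
    unfolding xy by (rule ratk_fraction[symmetric]) (use x y in simp)
  finally show ?thesis using of_int_cancel[of "b * d"] x y by (metis mult_eq_0_iff)
qed

lemma ratk_of_int: "ratk (of_int a) = (of_int a :: 'k)"
  using ratk_fraction[of 1 a] by simp

lemma ratk_0_1: "ratk 0 = (0 :: 'k)" "ratk 1 = (1 :: 'k)"
  using ratk_of_int[of 0] ratk_of_int[of 1] by simp_all

lemma ratk_sum: "ratk (sum f I) = (\<Sum>i\<in>I. ratk (f i) :: 'k)"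
  by (induction I rule: infinite_finite_induct) (simp_all add: ratk_0_1 ratk_add)

lemma ratk_sum_mset: "ratk (\<Sum>i\<in>#I. f i) = (\<Sum>i\<in>#I. ratk (f i) :: 'k)"
  by (induction I) (simp_all add: ratk_0_1 ratk_add)

lemma ratk_power: "ratk (x ^ n) = (ratk x ^ n :: 'k)"
  by (induction n) (simp_all add: ratk_0_1 ratk_mult)

lemma ratk_poly:
  assumes "degree p \<le> D"
  shows "ratk (poly p x) = (\<Sum>j\<le>D. ratk (coeff p j) * ratk x ^ j :: 'k)"
proof -
  have "poly p x = (\<Sum>j\<le>D. coeff p j * x ^ j)"
    unfolding poly_altdef using assms by (intro sum.mono_neutral_left) (auto simp: coeff_eq_0)
  then show ?thesis by (simp add: ratk_sum ratk_mult ratk_power)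
qed

text \<open>Evaluating at \<open>t = -1/2 - N\<close>, where \<open>N\<close> is the least length occurring in the relation,
  isolates a single coefficient.\<close>
lemma Mk_independent:
  fixes c :: "nat list \<Rightarrow> 'k"
  assumes S: "finite S" and 0: "\<And>m j. pt_lincomb c S m j = 0"
  shows "\<forall>a\<in>S. c a = 0"
proof (rule ccontr)
  assume "\<not> (\<forall>a\<in>S. c a = 0)"
  then obtain a0 where "a0 \<in> S \<and> c a0 \<noteq> 0" by blast
  from ex_has_least_nat[of "\<lambda>a. a \<in> S \<and> c a \<noteq> 0", OF this, of length]
  obtain a where a: "a \<in> S" "c a \<noteq> 0" and min: "\<And>b. b \<in> S \<Longrightarrow> c b \<noteq> 0 \<Longrightarrow> length a \<le> length b"
    by blast
  define m where "m = mono_of [1..<Suc (length a)] a"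
  define x :: rat where "x = - 1 / 2 - of_nat (length a)"
  \<comment> \<open>A common degree bound, so that evaluation at \<open>x\<close> is one finite sum
    over \<open>j\<close> for all words at once.\<close>
  define D where "D = Max ((\<lambda>b. degree (Mrat b m)) ` S)"
  have D: "degree (Mrat b m) \<le> D" if "b \<in> S" for b using S that by (simp add: D_def)
  have "0 = (\<Sum>j\<le>D. pt_lincomb c S m j * ratk x ^ j)" by (simp add: 0)
  also have "\<dots> = (\<Sum>j\<le>D. \<Sum>b\<in>S. c b * (ratk (coeff (Mrat b m) j) * ratk x ^ j))"
    by (simp add: pt_lincomb_def Mk_def sum_distrib_right mult.assoc)
  also have "\<dots> = (\<Sum>b\<in>S. \<Sum>j\<le>D. c b * (ratk (coeff (Mrat b m) j) * ratk x ^ j))" by (rule sum.swap)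
  also have "\<dots> = (\<Sum>b\<in>S. c b * ratk (poly (Mrat b m) x))"
    by (intro sum.cong) (simp_all add: ratk_poly[OF D] sum_distrib_left)
  also have "\<dots> = (\<Sum>b\<in>S. if b = a then c a else 0)"
  proof (intro sum.cong refl)
    fix b assume b: "b \<in> S"
    show "c b * ratk (poly (Mrat b m) x) = (if b = a then c a else 0)"
    proof (cases "c b = 0")
      case True
      then show ?thesis using a by auto
    next
      case False
      have "poly (Mrat b m) x = of_nat (if a = b then 1 else 0)"
        unfolding x_def m_def poly_Mrat[OF top_var_interval] fin_M_triangular[OF min[OF b False]] ..
      then show ?thesis by (auto simp: ratk_0_1)
    qed
  qed
  also have "\<dots> = c a" using S a by simp
  finally show False using a by simp
qed

lemma Mk_Nil: "Mk [] = (pt_one :: 'k pt)"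
proof -
  have "Mrat [] m = (if m = 0 then 1 else 0)" for m
    using Mrat_eq[of "[]" 0 m] by (simp add: idx_set_Nil gchoose_poly_def)
  then show ?thesis
    by (auto simp: fun_eq_iff Mk_def pt_one_def ratk_0_1)
qed

lemma Mk_mult: "pt_mult (Mk a) (Mk b) m j = (\<Sum>w\<in>#qsh a b. Mk w m j :: 'k)"
proof -
  have splits: "(\<Sum>q\<in>{(j1, j2). j1 + j2 = j}. ratk (coeff p (fst q)) * ratk (coeff p' (snd q)) :: 'k)
     = ratk (coeff (p * p') j)" for p p' :: "rat poly"
  proof -
    have "(\<Sum>q\<in>{(j1, j2). j1 + j2 = j}. ratk (coeff p (fst q)) * ratk (coeff p' (snd q)) :: 'k)
      = (\<Sum>i\<le>j. ratk (coeff p i) * ratk (coeff p' (j - i)))"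
      by (rule sum.reindex_bij_witness[of _ "\<lambda>i. (i, j - i)" fst]) auto
    then show ?thesis by (simp add: coeff_mult ratk_sum ratk_mult)
  qed
  have "pt_mult (Mk a) (Mk b) m j
     = (\<Sum>p\<in>{(m1, m2). m1 + m2 = m}. ratk (coeff (Mrat a (fst p) * Mrat b (snd p)) j) :: 'k)"
    unfolding pt_mult_def Mk_def splits ..
  also have "\<dots> = ratk (coeff (\<Sum>w\<in>#qsh a b. Mrat w m) j)"
    by (simp only: Mrat_mult [symmetric] coeff_sum ratk_sum)
  finally show ?thesis by (simp add: coeff_sum_mset ratk_sum_mset Mk_def)
qed

end

section \<open>Bilinearity and the isomorphism with the quasi-shuffle algebra\<close>

lemma pt_mult_sum_left:
  "pt_mult (\<lambda>m j. \<Sum>a\<in>A. u a * F a m j) g m j = (\<Sum>a\<in>A. u a * pt_mult (F a) g m j)"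
proof -
  let ?P = "{(m1, m2). m1 + m2 = m}" and ?Q = "{(j1, j2). j1 + j2 = j}"
  let ?h = "\<lambda>a p q. u a * (F a (fst p) (fst q) * g (snd p) (snd q))"
  have "pt_mult (\<lambda>m j. \<Sum>a\<in>A. u a * F a m j) g m j = (\<Sum>p\<in>?P. \<Sum>q\<in>?Q. \<Sum>a\<in>A. ?h a p q)"
    by (simp add: pt_mult_def sum_distrib_right mult.assoc)
  also have "\<dots> = (\<Sum>p\<in>?P. \<Sum>a\<in>A. \<Sum>q\<in>?Q. ?h a p q)"
    by (intro sum.cong refl sum.swap)
  also have "\<dots> = (\<Sum>a\<in>A. \<Sum>p\<in>?P. \<Sum>q\<in>?Q. ?h a p q)" by (rule sum.swap)
  finally show ?thesis by (simp add: pt_mult_def sum_distrib_left)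
qed

lemma pt_mult_sum_right:
  "pt_mult g (\<lambda>m j. \<Sum>a\<in>A. u a * F a m j) m j = (\<Sum>a\<in>A. u a * pt_mult g (F a) m j)"
proof -
  let ?P = "{(m1, m2). m1 + m2 = m}" and ?Q = "{(j1, j2). j1 + j2 = j}"
  let ?h = "\<lambda>a p q. u a * (g (fst p) (fst q) * F a (snd p) (snd q))"
  have "pt_mult g (\<lambda>m j. \<Sum>a\<in>A. u a * F a m j) m j = (\<Sum>p\<in>?P. \<Sum>q\<in>?Q. \<Sum>a\<in>A. ?h a p q)"
    by (simp add: pt_mult_def sum_distrib_left mult.left_commute)
  also have "\<dots> = (\<Sum>p\<in>?P. \<Sum>a\<in>A. \<Sum>q\<in>?Q. ?h a p q)"
    by (intro sum.cong refl sum.swap)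
  also have "\<dots> = (\<Sum>a\<in>A. \<Sum>p\<in>?P. \<Sum>q\<in>?Q. ?h a p q)" by (rule sum.swap)
  finally show ?thesis by (simp add: pt_mult_def sum_distrib_left)
qed

lemma sum_count_eq_sum_mset:
  fixes f :: "'a \<Rightarrow> 'b::comm_ring_1"
  assumes "finite W" "set_mset M \<subseteq> W"
  shows "(\<Sum>w\<in>W. of_nat (count M w) * f w) = (\<Sum>w\<in>#M. f w)"
  using assms(2)
proof (induction M)
  case (add x M)
  have "(\<Sum>w\<in>W. of_nat (count (add_mset x M) w) * f w)
     = (\<Sum>w\<in>W. (if w = x then f x else 0) + of_nat (count M w) * f w)"
    by (intro sum.cong) (auto simp: algebra_simps)
  also have "\<dots> = f x + (\<Sum>w\<in>W. of_nat (count M w) * f w)"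
    using add.prems assms(1) by (simp add: sum.distrib)
  finally show ?case using add by simp
qed simp

lemma pt_lincomb_superset:
  assumes "finite S" "{a. c a \<noteq> 0} \<subseteq> S"
  shows "pt_lincomb c {a. c a \<noteq> 0} = pt_lincomb c S"
  unfolding pt_lincomb_def using assms
  by (intro ext sum.mono_neutral_left) auto

definition QS_to_RenQSym :: "(nat list \<Rightarrow> 'k::comm_ring_1) \<Rightarrow> 'k pt" where
  "QS_to_RenQSym u = pt_lincomb u {a. u a \<noteq> 0}"

lemma QS_to_RenQSym_eq:
  assumes "finite S" "{a. u a \<noteq> 0} \<subseteq> S"
  shows "QS_to_RenQSym u m j = (\<Sum>a\<in>S. u a * Mk a m j)"
  unfolding QS_to_RenQSym_def pt_lincomb_superset[OF assms] by (simp add: pt_lincomb_def)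

lemma QS_to_RenQSym_add:
  assumes "u \<in> QS" "v \<in> QS"
  shows "QS_to_RenQSym (\<lambda>w. u w + v w) = (\<lambda>m j. QS_to_RenQSym u m j + QS_to_RenQSym v m j)"
proof (intro ext)
  fix m j
  let ?S = "{a. u a \<noteq> 0} \<union> {a. v a \<noteq> 0}"
  have S: "finite ?S" using assms by (simp add: QS_def)
  show "QS_to_RenQSym (\<lambda>w. u w + v w) m j = QS_to_RenQSym u m j + QS_to_RenQSym v m j"
    using QS_to_RenQSym_eq[OF S, of u m j] QS_to_RenQSym_eq[OF S, of v m j]
      QS_to_RenQSym_eq[OF S, of "\<lambda>w. u w + v w" m j]
    by (force simp: sum.distrib distrib_right)
qed

lemma QS_to_RenQSym_scale:
  assumes "u \<in> QS"
  shows "QS_to_RenQSym (\<lambda>w. c * u w) = (\<lambda>m j. c * QS_to_RenQSym u m j)"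
proof (intro ext)
  fix m j
  have S: "finite {a. u a \<noteq> 0}" using assms by (simp add: QS_def)
  show "QS_to_RenQSym (\<lambda>w. c * u w) m j = c * QS_to_RenQSym u m j"
    using QS_to_RenQSym_eq[OF S, of u m j] QS_to_RenQSym_eq[OF S, of "\<lambda>w. c * u w" m j]
    by (force simp: sum_distrib_left mult.assoc)
qed

lemma QS_to_RenQSym_surj: "QS_to_RenQSym ` QS = (RenQSym :: 'k::comm_ring_1 pt set)"
proof (intro equalityI subsetI)
  fix x :: "'k pt" assume "x \<in> RenQSym"
  then obtain c S where x: "x = pt_lincomb c S" and S: "finite S" by (auto simp: RenQSym_def)
  \<comment> \<open>The given \<open>c\<close> is arbitrary outside \<open>S\<close>; cutting it off
    there makes its support finite.\<close>
  let ?c = "\<lambda>a. if a \<in> S then c a else 0"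
  have "QS_to_RenQSym ?c = x"
  proof (intro ext)
    fix m j
    have "QS_to_RenQSym ?c m j = (\<Sum>a\<in>S. ?c a * Mk a m j)"
      by (rule QS_to_RenQSym_eq[OF S]) auto
    then show "QS_to_RenQSym ?c m j = x m j" by (simp add: x pt_lincomb_def)
  qed
  moreover have "?c \<in> QS" using S by (auto simp: QS_def)
  ultimately show "x \<in> QS_to_RenQSym ` QS" by blast
qed (auto simp: RenQSym_def QS_def QS_to_RenQSym_def)

lemma QS_to_RenQSym_inj:
  fixes u v :: "nat list \<Rightarrow> 'k::comm_ring_1"
  assumes "\<forall>n::nat. 0 < n \<longrightarrow> (\<exists>y::'k. of_nat n * y = 1)"
    and "u \<in> QS" "v \<in> QS" "QS_to_RenQSym u = QS_to_RenQSym v"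
  shows "u = v"
proof -
  let ?S = "{a. u a \<noteq> 0} \<union> {a. v a \<noteq> 0}"
  have S: "finite ?S" using assms by (simp add: QS_def)
  have "pt_lincomb (\<lambda>a. u a - v a) ?S m j = QS_to_RenQSym u m j - QS_to_RenQSym v m j" for m j
    using QS_to_RenQSym_eq[OF S, of u m j] QS_to_RenQSym_eq[OF S, of v m j]
    by (simp add: pt_lincomb_def sum_subtractf left_diff_distrib)
  then have "\<forall>a\<in>?S. u a - v a = 0"
    using assms by (intro Mk_independent[OF assms(1) S]) simp
  then have "u a - v a = 0" if "a \<in> ?S" for a using that by (rule bspec)
  moreover have "u a = v a" if "a \<notin> ?S" for a using that by simp
  ultimately show ?thesis by (meson ext eq_iff_diff_eq_0)
qed

lemma QS_to_RenQSym_mult: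
  fixes u v :: "nat list \<Rightarrow> 'k::comm_ring_1"
  assumes Q: "\<forall>n::nat. 0 < n \<longrightarrow> (\<exists>y::'k. of_nat n * y = 1)"
    and "u \<in> QS" "v \<in> QS"
  shows "QS_to_RenQSym (qs_mult u v) = pt_mult (QS_to_RenQSym u) (QS_to_RenQSym v)"
proof (intro ext)
  fix m j
  define A B where "A = {a. u a \<noteq> 0}" and "B = {b. v b \<noteq> 0}"
  have fin: "finite A" "finite B" using assms by (auto simp: A_def B_def QS_def)
  \<comment> \<open>A finite set holding every word of every product involved, which permits
    interchanging the sums.\<close>
  define W where "W = (\<Union>a\<in>A. \<Union>b\<in>B. set_mset (qsh a b))"
  have W: "finite W" using fin by (simp add: W_def)
  have supp: "{w. qs_mult u v w \<noteq> 0} \<subseteq> W"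
  proof
    fix w assume "w \<in> {w. qs_mult u v w \<noteq> 0}"
    then have "(\<Sum>a\<in>A. \<Sum>b\<in>B. u a * v b * of_nat (count (qsh a b) w)) \<noteq> 0"
      by (simp add: qs_mult_def A_def B_def)
    then obtain a where a: "a \<in> A" "(\<Sum>b\<in>B. u a * v b * of_nat (count (qsh a b) w)) \<noteq> 0"
      by (meson sum.not_neutral_contains_not_neutral)
    then obtain b where "b \<in> B" "u a * v b * of_nat (count (qsh a b) w) \<noteq> 0"
      by (meson sum.not_neutral_contains_not_neutral)
    then have "count (qsh a b) w \<noteq> 0" by (metis mult_zero_right of_nat_0)
    then have "w \<in># qsh a b" by (simp add: count_eq_zero_iff)
    then show "w \<in> W" using a \<open>b \<in> B\<close> by (auto simp: W_def)
  qed
  let ?h = "\<lambda>a b w. u a * v b * (of_nat (count (qsh a b) w) * Mk w m j)"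
  have "QS_to_RenQSym (qs_mult u v) m j = (\<Sum>w\<in>W. \<Sum>a\<in>A. \<Sum>b\<in>B. ?h a b w)"
    unfolding QS_to_RenQSym_eq[OF W supp]
    by (simp add: qs_mult_def sum_distrib_right mult.assoc flip: A_def B_def)
  also have "\<dots> = (\<Sum>a\<in>A. \<Sum>w\<in>W. \<Sum>b\<in>B. ?h a b w)" by (rule sum.swap)
  also have "\<dots> = (\<Sum>a\<in>A. \<Sum>b\<in>B. \<Sum>w\<in>W. ?h a b w)" by (intro sum.cong refl sum.swap)
  also have "\<dots> = (\<Sum>a\<in>A. \<Sum>b\<in>B. u a * (v b * pt_mult (Mk a) (Mk b) m j))"
  proof (intro sum.cong refl)
    fix a b assume "a \<in> A" "b \<in> B"
    then have "set_mset (qsh a b) \<subseteq> W" by (auto simp: W_def)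
    then have "(\<Sum>w\<in>W. of_nat (count (qsh a b) w) * Mk w m j :: 'k) = pt_mult (Mk a) (Mk b) m j"
      unfolding Mk_mult[OF Q] by (rule sum_count_eq_sum_mset[OF W])
    then show "(\<Sum>w\<in>W. ?h a b w) = u a * (v b * pt_mult (Mk a) (Mk b) m j)"
      by (simp add: mult.assoc flip: sum_distrib_left)
  qed
  also have "\<dots> = pt_mult (\<lambda>m j. \<Sum>a\<in>A. u a * Mk a m j) (\<lambda>m j. \<Sum>b\<in>B. v b * Mk b m j) m j"
    by (simp add: pt_mult_sum_left pt_mult_sum_right sum_distrib_left)
  finally show "QS_to_RenQSym (qs_mult u v) m j = pt_mult (QS_to_RenQSym u) (QS_to_RenQSym v) m j"
    by (simp add: QS_to_RenQSym_def pt_lincomb_def A_def B_def)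
qed

lemma QS_to_RenQSym_one:
  assumes "\<forall>n::nat. 0 < n \<longrightarrow> (\<exists>y::'k::comm_ring_1. of_nat n * y = 1)"
  shows "QS_to_RenQSym qs_one = (pt_one :: 'k pt)"
proof -
  have "QS_to_RenQSym qs_one m j = (\<Sum>a\<in>{[]}. qs_one a * Mk a m j :: 'k)" for m j
    by (rule QS_to_RenQSym_eq) (auto simp: qs_one_def)
  then show ?thesis by (simp add: fun_eq_iff qs_one_def Mk_Nil[OF assms])
qed

theorem theorem5p11:
  fixes ty :: "'k::comm_ring_1 itself"
  assumes containsQ: "\<forall>n::nat. 0 < n \<longrightarrow> (\<exists>y::'k. of_nat n * y = 1)"
  shows "(\<forall>x \<in> (RenQSym :: 'k pt set). \<exists>!c :: nat list \<Rightarrow> 'k.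
            finite {a. c a \<noteq> 0} \<and> x = pt_lincomb c {a. c a \<noteq> 0})
       \<and> (\<exists>\<Phi> :: (nat list \<Rightarrow> 'k) \<Rightarrow> 'k pt.
            bij_betw \<Phi> QS RenQSym
          \<and> (\<forall>u\<in>QS. \<forall>v\<in>QS. \<Phi> (\<lambda>w. u w + v w) = (\<lambda>m j. \<Phi> u m j + \<Phi> v m j))
          \<and> (\<forall>c. \<forall>u\<in>QS. \<Phi> (\<lambda>w. c * u w) = (\<lambda>m j. c * \<Phi> u m j))
          \<and> (\<forall>u\<in>QS. \<forall>v\<in>QS. \<Phi> (qs_mult u v) = pt_mult (\<Phi> u) (\<Phi> v))
          \<and> \<Phi> qs_one = pt_one)"
proof (intro conjI ballI exI[of _ "QS_to_RenQSym :: (nat list \<Rightarrow> 'k) \<Rightarrow> 'k pt"] allI)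
  show bij: "bij_betw (QS_to_RenQSym :: (nat list \<Rightarrow> 'k) \<Rightarrow> 'k pt) QS RenQSym"
    unfolding bij_betw_def using QS_to_RenQSym_surj QS_to_RenQSym_inj[OF containsQ]
    by (auto simp: inj_on_def)
  fix x :: "'k pt" assume "x \<in> RenQSym"
  then obtain c where c: "c \<in> QS" "x = QS_to_RenQSym c" using QS_to_RenQSym_surj by blast
  \<comment> \<open>A finitely supported \<open>c\<close> is an element of \<open>QS\<close>, so
    unique expansion is the bijectivity of the map.\<close>
  show "\<exists>!c. finite {a. c a \<noteq> 0} \<and> x = pt_lincomb c {a. c a \<noteq> 0}"
  proof (rule ex1I[of _ c])
    show "finite {a. c a \<noteq> 0} \<and> x = pt_lincomb c {a. c a \<noteq> 0}"
      using c by (simp add: QS_def QS_to_RenQSym_def)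
    fix d assume "finite {a. d a \<noteq> 0} \<and> x = pt_lincomb d {a. d a \<noteq> 0}"
    then have "d \<in> QS" "x = QS_to_RenQSym d" by (simp_all add: QS_def QS_to_RenQSym_def)
    then show "d = c" using c by (intro QS_to_RenQSym_inj[OF containsQ]) simp_all
  qed
qed (simp_all add: QS_to_RenQSym_add QS_to_RenQSym_scale QS_to_RenQSym_mult[OF containsQ]
    QS_to_RenQSym_one[OF containsQ])

end
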